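(* Let $n\ge1$ and let $\overrightarrow{B_n}$ be the directed bouquet of $n$ loops, modelled as the simple graph with central vertex $c$ and, for each loop $i=1,\dots,n$, a black vertex $b_i$ and a white vertex $w_i$ with edges $cb_i$, $b_iw_i$, $w_ic$ (the loop is oriented from $b_i$ to $w_i$). Its automorphism group is $S_n$, where $\sigma\in S_n$ fixes $c$ and sends $b_i\mapsto b_{\sigma(i)}$, $w_i\mapsto w_{\sigma(i)}$; cycle types are recorded on the $n$ directed loops. For a divisor $d$ of $n$, the number $i_d$ of unlabeled imbeddings of $\overrightarrow{B_n}$ that are $d$-fold symmetric, i.e. whose map-automorphism group is cyclic of order $d$ generated by a permutation of the $n$ loops with all cycles of length $d$ (the group $C_d[E_{n/d}]$), is \[ i_d=\frac{d}{2n}\sum_{k:\ d\mid k,\ k\mid n}\mu(k/d)\,\frac{(2n/k)!\,k^{n/k}}{(n/k)!},\] where $\mu$ is the Möbius function.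
   Context: A rotation at a vertex $v$ is a cyclic permutation of its neighborhood $N(v)$ (a single cycle through all of $N(v)$); a map is the graph together with a rotation system $\rho=\{\rho_v\}$ (so only the rotation at $c$, a cyclic ordering of the $2n$ vertices $b_i,w_i$, is a genuine choice). The group $S_n$ acts on maps by $\rho\mapsto\rho'$ with $\rho'_{\sigma(v)}=\sigma\rho_v\sigma^{-1}$; the stabilizer of a map $M$ is its map-automorphism group, and the $S_n$-orbits of maps are the unlabeled imbeddings. *)

theory Defs
  imports
    Complex_Main
    "HOL-Algebra.Sym_Groups"
    "HOL-Algebra.Group_Action"
    "HOL-Algebra.Generated_Groups"
    "HOL-Combinatorics.Orbits"
    "HOL-Computational_Algebra.Squarefree"
begin

datatype vertex = Center | Black nat | White nat

definition bouquet_verts :: "nat \<Rightarrow> vertex set" where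
  "bouquet_verts n = {Center} \<union> Black ` {1..n} \<union> White ` {1..n}"

definition bouquet_edges :: "nat \<Rightarrow> vertex set set" where
  "bouquet_edges n =
     (\<Union>i\<in>{1..n}. {{Center, Black i}, {Black i, White i}, {White i, Center}})"

definition nbhd :: "nat \<Rightarrow> vertex \<Rightarrow> vertex set" where
  "nbhd n v = {u. {u, v} \<in> bouquet_edges n}"

text \<open>The two colours record the direction of the loops, so automorphisms have to preserve them.\<close>

definition bouquet_automorphisms :: "nat \<Rightarrow> (vertex \<Rightarrow> vertex) set" where
  "bouquet_automorphisms n = {f. f permutes bouquet_verts n
     \<and> (\<forall>u\<in>bouquet_verts n. \<forall>v\<in>bouquet_verts n.
           {f u, f v} \<in> bouquet_edges n \<longleftrightarrow> {u, v} \<in> bouquet_edges n)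
     \<and> f ` Black ` {1..n} = Black ` {1..n}
     \<and> f ` White ` {1..n} = White ` {1..n}}"

primrec lift_perm :: "(nat \<Rightarrow> nat) \<Rightarrow> vertex \<Rightarrow> vertex" where
  "lift_perm \<sigma> Center = Center"
| "lift_perm \<sigma> (Black i) = Black (\<sigma> i)"
| "lift_perm \<sigma> (White i) = White (\<sigma> i)"

definition rotation_at :: "nat \<Rightarrow> vertex \<Rightarrow> (vertex \<Rightarrow> vertex) \<Rightarrow> bool" where
  "rotation_at n v r \<longleftrightarrow> r permutes nbhd n v \<and> cyclic_on r (nbhd n v)"

text \<open>The value outside the vertex set is fixed to be the identity, so that equality of functions
  is equality of rotation systems.\<close>

definition bouquet_maps :: "nat \<Rightarrow> (vertex \<Rightarrow> vertex \<Rightarrow> vertex) set" where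
  "bouquet_maps n = {\<rho>. (\<forall>v\<in>bouquet_verts n. rotation_at n v (\<rho> v))
                        \<and> (\<forall>v. v \<notin> bouquet_verts n \<longrightarrow> \<rho> v = id)}"

text \<open>This is \<open>\<rho>'\<^bsub>\<sigma>(v)\<^esub> = \<sigma> \<rho>\<^bsub>v\<^esub> \<sigma>\<inverse>\<close>, solved for the rotation at a given vertex. The restriction to
  \<open>bouquet_maps n\<close> is what \<^const>\<open>BijGroup\<close> expects.\<close>

definition map_action ::
  "nat \<Rightarrow> (nat \<Rightarrow> nat) \<Rightarrow> (vertex \<Rightarrow> vertex \<Rightarrow> vertex) \<Rightarrow> (vertex \<Rightarrow> vertex \<Rightarrow> vertex)" where
  "map_action n \<sigma> = (\<lambda>\<rho>\<in>bouquet_maps n.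
     (\<lambda>v. lift_perm \<sigma> \<circ> \<rho> (inv' (lift_perm \<sigma>) v) \<circ> inv' (lift_perm \<sigma>)))"

definition map_automorphism_group ::
  "nat \<Rightarrow> (vertex \<Rightarrow> vertex \<Rightarrow> vertex) \<Rightarrow> (nat \<Rightarrow> nat) set" where
  "map_automorphism_group n \<rho> = stabilizer (sym_group n) (map_action n) \<rho>"

definition unlabeled_imbeddings :: "nat \<Rightarrow> (vertex \<Rightarrow> vertex \<Rightarrow> vertex) set set" where
  "unlabeled_imbeddings n = orbits (sym_group n) (bouquet_maps n) (map_action n)"

definition d_fold_symmetric :: "nat \<Rightarrow> nat \<Rightarrow> (vertex \<Rightarrow> vertex \<Rightarrow> vertex) \<Rightarrow> bool" where
  "d_fold_symmetric n d \<rho> \<longleftrightarrow> (\<exists>\<sigma>\<in>carrier (sym_group n).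
     map_automorphism_group n \<rho> = generate (sym_group n) {\<sigma>}
     \<and> card (map_automorphism_group n \<rho>) = d
     \<and> (\<forall>i\<in>{1..n}. card (Orbits.orbit \<sigma> i) = d))"

text \<open>Maps in the same orbit have conjugate automorphism groups, so it makes no difference whether
  one or all of them are required to be \<open>d\<close>-fold symmetric.\<close>

definition num_d_fold :: "nat \<Rightarrow> nat \<Rightarrow> nat" where
  "num_d_fold n d = card {I \<in> unlabeled_imbeddings n. \<forall>\<rho>\<in>I. d_fold_symmetric n d \<rho>}"

definition moebius_mu :: "nat \<Rightarrow> int" where
  "moebius_mu m = (if squarefree m then (-1) ^ card (prime_factors m) else 0)"

lemma lift_perm_comp: "lift_perm (\<sigma> \<circ> \<tau>) = lift_perm \<sigma> \<circ> lift_perm \<tau>"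
proof
  fix v show "lift_perm (\<sigma> \<circ> \<tau>) v = (lift_perm \<sigma> \<circ> lift_perm \<tau>) v"
    by (cases v) auto
qed

lemma lift_perm_id: "lift_perm id = id"
proof
  fix v show "lift_perm id v = id v"
    by (cases v) auto
qed

lemma inj_lift_perm: "inj lift_perm"
  by (metis (no_types) injI ext lift_perm.simps(2) vertex.inject(1))

lemma lift_perm_bij:
  assumes "\<sigma> permutes {1..n}"
  shows "bij (lift_perm \<sigma>)" and "inv' (lift_perm \<sigma>) = lift_perm (inv' \<sigma>)"
proof -
  have 1: "lift_perm \<sigma> \<circ> lift_perm (inv' \<sigma>) = id" "lift_perm (inv' \<sigma>) \<circ> lift_perm \<sigma> = id"
    using permutes_inv_o[OF assms] by (simp_all flip: lift_perm_comp add: lift_perm_id)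
  then show "bij (lift_perm \<sigma>)" using o_bij by blast
  show "inv' (lift_perm \<sigma>) = lift_perm (inv' \<sigma>)"
    by (rule inv_unique_comp[OF 1])
qed

lemma bij_fixing_permutes:
  assumes "bij p" and "\<And>x. x \<notin> S \<Longrightarrow> p x = x"
  shows "p permutes S"
  using assms by (simp add: permutes_def bij_iff)

lemma lift_perm_permutes:
  assumes "\<sigma> permutes {1..n}"
  shows "lift_perm \<sigma> permutes bouquet_verts n"
proof (rule bij_fixing_permutes)
  show "bij (lift_perm \<sigma>)" by (rule lift_perm_bij[OF assms])
  fix x assume "x \<notin> bouquet_verts n"
  then show "lift_perm \<sigma> x = x"
    using permutes_not_in[OF assms] by (cases x) (auto simp: bouquet_verts_def image_iff)
qed

lemma edge_iff:
  "{u, v} \<in> bouquet_edges n \<longleftrightarrow> (\<exists>i\<in>{1..n}.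
     (u = Center \<and> v = Black i) \<or> (v = Center \<and> u = Black i) \<or>
     (u = Black i \<and> v = White i) \<or> (v = Black i \<and> u = White i) \<or>
     (u = White i \<and> v = Center) \<or> (v = White i \<and> u = Center))"
  by (auto simp: bouquet_edges_def doubleton_eq_iff)

lemma lift_perm_edge_imp:
  assumes "\<sigma> permutes {1..n}" and "{u, v} \<in> bouquet_edges n"
  shows "{lift_perm \<sigma> u, lift_perm \<sigma> v} \<in> bouquet_edges n"
proof -
  have "\<And>i. i \<in> {1..n} \<Longrightarrow> \<sigma> i \<in> {1..n}"
    using permutes_in_image[OF assms(1)] by blast
  then show ?thesis using assms(2) unfolding edge_iff by (elim bexE disjE) fastforce+
qed

lemma lift_perm_edge:
  assumes "\<sigma> permutes {1..n}"
  shows "{lift_perm \<sigma> u, lift_perm \<sigma> v} \<in> bouquet_edges n \<longleftrightarrow> {u, v} \<in> bouquet_edges n"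
  using lift_perm_edge_imp[OF assms] lift_perm_edge_imp[OF permutes_inv[OF assms]]
    lift_perm_bij[OF assms] by (metis bij_is_inj inv_f_f)

lemma bouquet_automorphisms_eq:
  "bouquet_automorphisms n = lift_perm ` carrier (sym_group n)"
proof (intro equalityI subsetI)
  fix f assume "f \<in> lift_perm ` carrier (sym_group n)"
  then obtain \<sigma> where s: "\<sigma> permutes {1..n}" and f: "f = lift_perm \<sigma>"
    by (auto simp: sym_group_carrier)
  have "\<sigma> ` {1..n} = {1..n}" using permutes_image[OF s] .
  then have "lift_perm \<sigma> ` Black ` {1..n} = Black ` {1..n}"
    "lift_perm \<sigma> ` White ` {1..n} = White ` {1..n}"
    by (simp_all add: image_image) (metis image_image)+
  then show "f \<in> bouquet_automorphisms n"
    using lift_perm_permutes[OF s] lift_perm_edge[OF s]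
    by (simp add: bouquet_automorphisms_def f)
next
  fix f assume "f \<in> bouquet_automorphisms n"
  then have p: "f permutes bouquet_verts n"
    and e: "\<And>u v. u \<in> bouquet_verts n \<Longrightarrow> v \<in> bouquet_verts n \<Longrightarrow>
        {f u, f v} \<in> bouquet_edges n \<longleftrightarrow> {u, v} \<in> bouquet_edges n"
    and b: "f ` Black ` {1..n} = Black ` {1..n}"
    and w: "f ` White ` {1..n} = White ` {1..n}"
    by (auto simp: bouquet_automorphisms_def)
  have inj: "inj f" using p permutes_inj by blast
  have "f Center \<in> bouquet_verts n"
    using permutes_in_image[OF p] by (simp add: bouquet_verts_def)
  moreover have "f Center \<notin> f ` Black ` {1..n}" "f Center \<notin> f ` White ` {1..n}"
    using inj by (auto dest: injD)
  ultimately have c: "f Center = Center"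
    unfolding b w by (auto simp: bouquet_verts_def)
  define \<sigma> where "\<sigma> i = (if i \<in> {1..n} then (THE j. f (Black i) = Black j) else i)" for i
  have fb: "f (Black i) = Black (\<sigma> i)" and s: "\<sigma> i \<in> {1..n}" if "i \<in> {1..n}" for i
  proof -
    have "f (Black i) \<in> f ` Black ` {1..n}" using that by (intro imageI)
    then have "f (Black i) \<in> Black ` {1..n}" unfolding b .
    then show "f (Black i) = Black (\<sigma> i)" "\<sigma> i \<in> {1..n}" using that by (auto simp: \<sigma>_def)
  qed
  have fw: "f (White i) = White (\<sigma> i)" if "i \<in> {1..n}" for i
  proof -
    have "f (White i) \<in> f ` White ` {1..n}" using that by (intro imageI)
    then obtain j where j: "f (White i) = White j" unfolding w by (elim imageE)
    have "{Black i, White i} \<in> bouquet_edges n" using that unfolding edge_iff by blast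
    then have "{f (Black i), f (White i)} \<in> bouquet_edges n"
      using e[of "Black i" "White i"] that by (simp add: bouquet_verts_def)
    then show ?thesis unfolding fb[OF that] j by (auto simp: edge_iff)
  qed
  have "\<sigma> permutes {1..n}"
  proof (rule bij_imp_permutes)
    have "inj_on \<sigma> {1..n}"
    proof (rule inj_onI)
      fix i j assume "i \<in> {1..n}" "j \<in> {1..n}" "\<sigma> i = \<sigma> j"
      then have "f (Black i) = f (Black j)" by (simp only: fb)
      then show "i = j" using injD[OF inj] by blast
    qed
    moreover from this have "\<sigma> ` {1..n} = {1..n}"
      using s by (intro endo_inj_surj) auto
    ultimately show "bij_betw \<sigma> {1..n} {1..n}" by (simp add: bij_betw_def)
  qed (auto simp: \<sigma>_def)
  moreover have "f = lift_perm \<sigma>"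
  proof
    fix v show "f v = lift_perm \<sigma> v"
    proof (cases "v \<in> bouquet_verts n")
      case True
      then show ?thesis using c fb fw by (auto simp: bouquet_verts_def)
    next
      case False
      then show ?thesis
        using permutes_not_in[OF p False] permutes_not_in[OF lift_perm_permutes[OF calculation] False]
        by simp
    qed
  qed
  ultimately show "f \<in> lift_perm ` carrier (sym_group n)"
    by (auto simp: sym_group_carrier)
qed

lemma map_action_closed:
  assumes s: "\<sigma> permutes {1..n}" and r: "\<rho> \<in> bouquet_maps n"
  shows "map_action n \<sigma> \<rho> \<in> bouquet_maps n"
proof -
  let ?f = "lift_perm \<sigma>"
  have bij: "bij ?f" by (rule lift_perm_bij[OF s])
  have p: "?f permutes bouquet_verts n" by (rule lift_perm_permutes[OF s])
  have nb: "nbhd n v = ?f ` nbhd n (inv' ?f v)" for v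
  proof -
    have "u \<in> ?f ` nbhd n (inv' ?f v) \<longleftrightarrow> u \<in> nbhd n v" for u
      using lift_perm_edge[OF s, of "inv' ?f u" "inv' ?f v"] bij
      by (auto simp: nbhd_def bij_is_surj surj_f_inv_f bij_is_inj image_iff)
    then show ?thesis by blast
  qed
  have "rotation_at n v (?f \<circ> \<rho> (inv' ?f v) \<circ> inv' ?f)" if "v \<in> bouquet_verts n" for v
  proof -
    let ?u = "inv' ?f v"
    let ?g = "?f \<circ> \<rho> ?u \<circ> inv' ?f"
    have "?u \<in> bouquet_verts n" using that permutes_in_image[OF permutes_inv[OF p]] by blast
    then have ru: "\<rho> ?u permutes nbhd n ?u" and cu: "cyclic_on (\<rho> ?u) (nbhd n ?u)"
      using r by (auto simp: bouquet_maps_def rotation_at_def)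
    have 1: "?g permutes nbhd n v"
    proof (rule bij_fixing_permutes)
      show "bij ?g"
        using bij permutes_bij[OF ru] by (intro bij_comp bij_imp_bij_inv)
      fix x assume "x \<notin> nbhd n v"
      then have "inv' ?f x \<notin> nbhd n ?u"
        using nb[of v] bij by (metis bij_inv_eq_iff image_eqI)
      then show "?g x = x" using permutes_not_in[OF ru] bij
        by (simp add: bij_is_surj surj_f_inv_f)
    qed
    from cu obtain s0 where s0: "s0 \<in> nbhd n ?u" "nbhd n ?u = Orbits.orbit (\<rho> ?u) s0"
      by (auto simp: cyclic_on_def)
    have pow: "(?g ^^ k) (?f s0) = ?f ((\<rho> ?u ^^ k) s0)" for k
      using bij by (induction k) (auto simp: bij_is_inj)
    have "nbhd n v = Orbits.orbit ?g (?f s0)"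
      unfolding nb[of v] s0(2) orbit_altdef pow by auto
    moreover have "?f s0 \<in> nbhd n v" unfolding nb[of v] using s0(1) by blast
    ultimately show ?thesis using 1 unfolding rotation_at_def cyclic_on_def by blast
  qed
  moreover have "?f \<circ> \<rho> (inv' ?f v) \<circ> inv' ?f = id" if "v \<notin> bouquet_verts n" for v
  proof -
    have "inv' ?f v = v" using permutes_not_in[OF permutes_inv[OF p] that] .
    then show ?thesis
      using r that permutes_inv_o[OF p] by (simp add: bouquet_maps_def)
  qed
  ultimately show ?thesis using r by (auto simp: map_action_def bouquet_maps_def)
qed

lemma map_action_comp:
  assumes "\<sigma> permutes {1..n}" and "\<tau> permutes {1..n}" and "\<rho> \<in> bouquet_maps n"
  shows "map_action n (\<sigma> \<circ> \<tau>) \<rho> = map_action n \<sigma> (map_action n \<tau> \<rho>)"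
proof -
  have "inv' (lift_perm (\<sigma> \<circ> \<tau>)) = inv' (lift_perm \<tau>) \<circ> inv' (lift_perm \<sigma>)"
    unfolding lift_perm_comp
    by (rule o_inv_distrib) (rule lift_perm_bij[OF assms(1)] lift_perm_bij[OF assms(2)])+
  moreover have "map_action n \<tau> \<rho> \<in> bouquet_maps n"
    using assms map_action_closed by blast
  ultimately show ?thesis
    using assms(3) by (simp add: map_action_def lift_perm_comp comp_assoc)
qed

lemma map_action_id:
  assumes "\<rho> \<in> bouquet_maps n" shows "map_action n id \<rho> = \<rho>"
  using assms by (simp add: map_action_def lift_perm_id)

lemma group_action_bouquet_maps:
  "group_action (sym_group n) (bouquet_maps n) (map_action n)"
proof (intro group_action.intro group_hom.intro group_hom_axioms.intro)
  show "Group.group (sym_group n)" by (rule sym_group_is_group)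
  show "Group.group (BijGroup (bouquet_maps n))" by (rule group_BijGroup)
  have bij: "map_action n \<sigma> \<in> Bij (bouquet_maps n)" if "\<sigma> permutes {1..n}" for \<sigma>
  proof -
    have "bij_betw (map_action n \<sigma>) (bouquet_maps n) (bouquet_maps n)"
    proof (rule bij_betw_byWitness[where f' = "map_action n (inv' \<sigma>)"])
      show "\<forall>\<rho>\<in>bouquet_maps n. map_action n (inv' \<sigma>) (map_action n \<sigma> \<rho>) = \<rho>"
        using map_action_comp[OF permutes_inv[OF that] that] permutes_inv_o[OF that] map_action_id
        by metis
      show "\<forall>\<rho>\<in>bouquet_maps n. map_action n \<sigma> (map_action n (inv' \<sigma>) \<rho>) = \<rho>"
        using map_action_comp[OF that permutes_inv[OF that]] permutes_inv_o[OF that] map_action_id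
        by metis
    qed (use map_action_closed that permutes_inv[OF that] in blast)+
    then show ?thesis by (simp add: Bij_def map_action_def)
  qed
  show "map_action n \<in> hom (sym_group n) (BijGroup (bouquet_maps n))"
  proof (rule homI)
    fix \<sigma> assume "\<sigma> \<in> carrier (sym_group n)"
    then show "map_action n \<sigma> \<in> carrier (BijGroup (bouquet_maps n))"
      using bij by (simp add: BijGroup_def sym_group_carrier)
  next
    fix \<sigma> \<tau> assume "\<sigma> \<in> carrier (sym_group n)" "\<tau> \<in> carrier (sym_group n)"
    then have st: "\<sigma> permutes {1..n}" "\<tau> permutes {1..n}" by (simp_all add: sym_group_carrier)
    have "map_action n (\<sigma> \<circ> \<tau>) = compose (bouquet_maps n) (map_action n \<sigma>) (map_action n \<tau>)"
    proof
      fix \<rho> show "map_action n (\<sigma> \<circ> \<tau>) \<rho>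
          = compose (bouquet_maps n) (map_action n \<sigma>) (map_action n \<tau>) \<rho>"
        by (cases "\<rho> \<in> bouquet_maps n")
           (simp_all add: compose_def map_action_comp[OF st], simp add: map_action_def)
    qed
    then show "map_action n (\<sigma> \<otimes>\<^bsub>sym_group n\<^esub> \<tau>)
        = map_action n \<sigma> \<otimes>\<^bsub>BijGroup (bouquet_maps n)\<^esub> map_action n \<tau>"
      using bij st by (simp add: BijGroup_def sym_group_mult)
  qed
qed

end

theory Submission
  imports Defs
begin

text \<open>
  A map is determined by its rotation \<open>r\<close> at the centre, a cyclic permutation of the \<open>2n\<close> neighbours,
  and its automorphisms are the \<open>\<sigma> \<in> S\<^sub>n\<close> that commute with \<open>r\<close>, i.e. act as powers of \<open>r\<close>. So the
  automorphism group is always cyclic and acts with all cycles of the same length: being \<open>d\<close>-fold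
  symmetric just means having \<open>d\<close> automorphisms, and for \<open>n = k m\<close> the order of the group is divisible by
  \<open>k\<close> iff \<open>r\<^bsup>2m\<^esup>\<close> comes from \<open>S\<^sub>n\<close>.

  Such \<open>r\<close> are counted by listing the neighbours periodically as \<open>f(i + 1) = r(f(i))\<close>, in \<open>2n\<close> ways for each
  \<open>r\<close>. The condition reads \<open>f(i + 2m) = \<sigma>(f(i))\<close> for some \<open>\<sigma>\<close> with all cycles of length \<open>k\<close>, and for
  each \<open>\<sigma>\<close> there are \<open>(2m)! k\<^bsup>2m\<^esup>\<close> listings, since \<open>f(0), \<dots>, f(2m-1)\<close> is an arbitrary ordered transversal of
  the \<open>2m\<close> cycles. The same count for listings of the \<open>n\<close> loops shows that there are
  \<open>n! / (m! k\<^sup>m)\<close> such \<open>\<sigma>\<close>. Moebius inversion isolates the maps with exactly \<open>d\<close> automorphisms, and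
  each of their orbits has \<open>n!/d\<close> elements.
\<close>

section \<open>Semiregular permutations and periodic listings\<close>

text \<open>Double counting: \<open>Q\<close> sends each element of \<open>W\<close> to one point of
  \<open>R\<close>, and all fibres have size \<open>c\<close>. Since infinite sets have
  \<open>card\<close> zero, \<open>c > 0\<close> makes the fibres finite.\<close>

lemma card_fibres_eq:
  assumes "finite R" and "c > 0"
    and "\<And>r. r \<in> R \<Longrightarrow> card {f \<in> W. Q r f} = c"
    and "\<And>f. f \<in> W \<Longrightarrow> \<exists>!r. r \<in> R \<and> Q r f"
  shows "card W = card R * c"
proof -
  have "W = (\<Union>r\<in>R. {f \<in> W. Q r f})" using assms(4) by blast
  also have "card \<dots> = (\<Sum>r\<in>R. card {f \<in> W. Q r f})"
  proof (rule card_UN_disjoint[OF assms(1)])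
    show "\<forall>r\<in>R. finite {f \<in> W. Q r f}"
      using assms(2,3) by (metis card_gt_0_iff)
    show "\<forall>r\<in>R. \<forall>s\<in>R. r \<noteq> s \<longrightarrow> {f \<in> W. Q r f} \<inter> {f \<in> W. Q s f} = {}"
      using assms(4) by blast
  qed
  also have "\<dots> = card R * c" using assms(3) by simp
  finally show ?thesis .
qed

text \<open>For \<open>k > 0\<close> this means that all cycles on \<open>X\<close> have length
  \<open>k\<close>. The formulation by return times turns cycle lengths into divisibility
  statements.\<close>

definition semiregular :: "nat \<Rightarrow> ('a \<Rightarrow> 'a) \<Rightarrow> 'a set \<Rightarrow> bool" where
  "semiregular k \<sigma> X \<longleftrightarrow> \<sigma> permutes X \<and> (\<forall>x\<in>X. \<forall>j. (\<sigma> ^^ j) x = x \<longleftrightarrow> k dvd j)"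

lemma semiregular_funpow_eq:
  assumes "semiregular k \<sigma> X" and "x \<in> X"
  shows "(\<sigma> ^^ i) x = (\<sigma> ^^ j) x \<longleftrightarrow> i mod k = j mod k"
proof -
  have *: "(\<sigma> ^^ i) x = (\<sigma> ^^ j) x \<longleftrightarrow> i mod k = j mod k" if "i \<le> j" for i j
  proof -
    have "inj (\<sigma> ^^ i)"
      using assms(1) by (meson inj_fn permutes_inj semiregular_def)
    moreover have "(\<sigma> ^^ j) x = (\<sigma> ^^ i) ((\<sigma> ^^ (j - i)) x)"
      using that by (metis comp_apply funpow_add le_add_diff_inverse)
    ultimately have "(\<sigma> ^^ i) x = (\<sigma> ^^ j) x \<longleftrightarrow> (\<sigma> ^^ (j - i)) x = x"
      by (simp add: inj_eq eq_commute)
    also have "\<dots> \<longleftrightarrow> k dvd j - i" using assms by (auto simp: semiregular_def)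
    also have "\<dots> \<longleftrightarrow> i mod k = j mod k"
      using that by (metis mod_eq_dvd_iff_nat)
    finally show ?thesis .
  qed
  show ?thesis using *[of i j] *[of j i] by (metis nat_le_linear)
qed

lemma semiregular_orbit:
  assumes "semiregular k \<sigma> X" and "k > 0" and "x \<in> X"
  shows "Orbits.orbit \<sigma> x = (\<lambda>i. (\<sigma> ^^ i) x) ` {..<k}" "card (Orbits.orbit \<sigma> x) = k"
proof -
  have "(\<sigma> ^^ k) x = x" using assms by (simp add: semiregular_def)
  then show *: "Orbits.orbit \<sigma> x = (\<lambda>i. (\<sigma> ^^ i) x) ` {..<k}"
    using assms(2) by (auto simp: orbit_altdef_bounded)
  have "inj_on (\<lambda>i. (\<sigma> ^^ i) x) {..<k}"
    by (rule inj_onI) (simp add: semiregular_funpow_eq[OF assms(1,3)])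
  then show "card (Orbits.orbit \<sigma> x) = k" unfolding * by (simp add: card_image)
qed

lemma orbit_eqI_permutes:
  assumes "\<sigma> permutes X" "finite X" "y \<in> Orbits.orbit \<sigma> x"
  shows "Orbits.orbit \<sigma> y = Orbits.orbit \<sigma> x"
  by (rule orbit_cyclic_eq3[OF cyclic_on_orbit[OF assms(1,2)] assms(3)])

lemma permutes_self_in_orbit:
  assumes "\<sigma> permutes X" "finite X"
  shows "x \<in> Orbits.orbit \<sigma> x"
  using assms by (intro permutation_self_in_orbit) (auto simp: permutation_permutes)

text \<open>Distinct orbits are disjoint and each has \<open>k\<close> elements.\<close>

lemma card_orbits_mult:
  assumes s: "semiregular k \<sigma> X" and "k > 0" and "finite X" and "Y \<subseteq> X"
  shows "card (\<Union>y\<in>Y. Orbits.orbit \<sigma> y) = k * card (Orbits.orbit \<sigma> ` Y)"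
proof -
  have p: "\<sigma> permutes X" using s by (simp add: semiregular_def)
  have "k * card (Orbits.orbit \<sigma> ` Y) = card (\<Union> (Orbits.orbit \<sigma> ` Y))"
  proof (rule card_partition)
    show "finite (Orbits.orbit \<sigma> ` Y)" using assms finite_subset by blast
    show "finite (\<Union> (Orbits.orbit \<sigma> ` Y))"
      using permutes_orbit_subset[OF p] assms(3,4) by (intro finite_subset[OF _ assms(3)]) blast
    fix c assume "c \<in> Orbits.orbit \<sigma> ` Y"
    then show "card c = k" using semiregular_orbit(2)[OF s assms(2)] assms(4) by blast
  next
    fix c d assume cd: "c \<in> Orbits.orbit \<sigma> ` Y" "d \<in> Orbits.orbit \<sigma> ` Y" "c \<noteq> d"
    have "Orbits.orbit \<sigma> z = c" "Orbits.orbit \<sigma> z = d" if "z \<in> c \<inter> d" for z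
      using cd(1,2) that orbit_eqI_permutes[OF p assms(3)] by auto
    then show "c \<inter> d = {}" using cd(3) by blast
  qed
  then show ?thesis by simp
qed

lemma semiregular_dvd_card:
  assumes "semiregular k \<sigma> X" and "k > 0" and "finite X"
  shows "k dvd card X"
proof -
  have p: "\<sigma> permutes X" using assms(1) by (simp add: semiregular_def)
  have "(\<Union>y\<in>X. Orbits.orbit \<sigma> y) = X"
    using permutes_orbit_subset[OF p] permutes_self_in_orbit[OF p assms(3)] by blast
  then show ?thesis using card_orbits_mult[OF assms subset_refl] by (metis dvd_triv_left)
qed

section \<open>Ordered choices of points from different cycles\<close>

definition transversals :: "('a \<Rightarrow> 'a) \<Rightarrow> 'a set \<Rightarrow> nat \<Rightarrow> 'a list set" where
  "transversals \<sigma> X L =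
     {xs. length xs = L \<and> set xs \<subseteq> X \<and> distinct (map (Orbits.orbit \<sigma>) xs)}"

text \<open>A list of \<open>L\<close> entries excludes \<open>L\<close> full cycles, so
  \<open>(N - L) * k\<close> choices remain for an entry in front of it. Truncated subtraction gives
  the factor 0 once all \<open>N\<close> cycles are used up.\<close>

lemma card_transversals:
  assumes s: "semiregular k \<sigma> X" and k: "k > 0" and X: "finite X" "card X = N * k"
  shows "card (transversals \<sigma> X L) = (\<Prod>j<L. (N - j) * k)"
proof (induction L)
  case 0
  have "transversals \<sigma> X 0 = {[]}" by (auto simp: transversals_def)
  then show ?case by simp
next
  case (Suc L)
  have p: "\<sigma> permutes X" using s by (simp add: semiregular_def)
  let ?A = "\<lambda>xs. X - (\<Union>y\<in>set xs. Orbits.orbit \<sigma> y)"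
  have eq: "transversals \<sigma> X (Suc L) = (\<Union>xs\<in>transversals \<sigma> X L. (\<lambda>x. x # xs) ` ?A xs)"
  proof (rule Set.set_eqI)
    fix zs
    \<comment> \<open>Turns distinctness of orbits into avoidance of the orbits already
      used.\<close>
    have iff: "Orbits.orbit \<sigma> x = Orbits.orbit \<sigma> y \<longleftrightarrow> x \<in> Orbits.orbit \<sigma> y" for x y
      using orbit_eqI_permutes[OF p X(1)] permutes_self_in_orbit[OF p X(1)] by metis
    show "zs \<in> transversals \<sigma> X (Suc L) \<longleftrightarrow> zs \<in> (\<Union>xs\<in>transversals \<sigma> X L. (\<lambda>x. x # xs) ` ?A xs)"
    proof (cases zs)
      case (Cons a xs)
      have "zs \<in> (\<Union>xs\<in>transversals \<sigma> X L. (\<lambda>x. x # xs) ` ?A xs)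
          \<longleftrightarrow> xs \<in> transversals \<sigma> X L \<and> a \<in> ?A xs"
        unfolding Cons by blast
      then show ?thesis unfolding Cons by (auto simp: transversals_def iff)
    qed (auto simp: transversals_def)
  qed
  have fin: "finite (transversals \<sigma> X L)"
    by (rule finite_subset[OF _ finite_lists_length_eq[OF X(1), of L]]) (auto simp: transversals_def)
  have "card (?A xs) = (N - L) * k" if "xs \<in> transversals \<sigma> X L" for xs
  proof -
    have xs: "set xs \<subseteq> X" "length xs = L" "distinct (map (Orbits.orbit \<sigma>) xs)"
      using that by (auto simp: transversals_def)
    have "card (Orbits.orbit \<sigma> ` set xs) = L"
      using distinct_card[OF xs(3)] xs(2) by simp
    then have "card (\<Union>y\<in>set xs. Orbits.orbit \<sigma> y) = k * L"
      using card_orbits_mult[OF s k X(1) xs(1)] by simp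
    moreover have "(\<Union>y\<in>set xs. Orbits.orbit \<sigma> y) \<subseteq> X"
      using permutes_orbit_subset[OF p] xs(1) by blast
    ultimately show ?thesis
      by (subst card_Diff_subset[OF finite_subset[OF _ X(1)]]) (simp_all add: X(2) diff_mult_distrib mult.commute[of k L])
  qed
  then have "card (transversals \<sigma> X (Suc L)) = card (transversals \<sigma> X L) * ((N - L) * k)"
    unfolding eq using fin X(1)
    by (subst card_UN_disjoint) (auto simp: card_image inj_on_def)
  then show ?case using Suc by simp
qed

lemma prod_diff_mult_eq_fact: "(\<Prod>j<N. (N - j) * k) = fact N * k ^ N" for N k :: nat
proof -
  have "(\<Prod>j<N. N - j) = fact N"
    by (simp add: fact_prod_rev atLeast0LessThan)
  then show ?thesis by (simp add: prod.distrib)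
qed

text \<open>For a permutation \<open>\<sigma>\<close> of a finite \<open>X\<close>, each block of
  \<open>N\<close> consecutive values is carried to the next one, so the first block determines
  \<open>f\<close>; \<open>range f = X\<close> forces that block to meet every cycle.\<close>

definition shift_sequences :: "nat \<Rightarrow> ('a \<Rightarrow> 'a) \<Rightarrow> 'a set \<Rightarrow> (nat \<Rightarrow> 'a) set" where
  "shift_sequences N \<sigma> X = {f. range f = X \<and> (\<forall>i. f (i + N) = \<sigma> (f i))}"

lemma shift_sequences_step:
  assumes "\<forall>i. f (i + N) = \<sigma> (f i)"
  shows "f (i + j * N) = (\<sigma> ^^ j) (f i)"
proof (induction j)
  case (Suc j)
  have "f (i + Suc j * N) = f ((i + j * N) + N)" by (simp add: algebra_simps)
  also have "\<dots> = \<sigma> (f (i + j * N))" using assms by blast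
  finally show ?case using Suc by simp
qed simp

text \<open>Restriction to the first \<open>N\<close> indices is a bijection onto the ordered
  transversals with one entry from each of the \<open>N\<close> cycles.\<close>

lemma card_shift_sequences:
  assumes s: "semiregular k \<sigma> X" and k: "k > 0" and X: "finite X" "card X = N * k" and N: "N > 0"
  shows "card (shift_sequences N \<sigma> X) = fact N * k ^ N"
proof -
  have p: "\<sigma> permutes X" using s by (simp add: semiregular_def)
  let ?o = "Orbits.orbit \<sigma>"
  have o: "?o x = {(\<sigma> ^^ i) x |i. True}" for x
    using orbit_altdef_self_in permutes_self_in_orbit[OF p X(1)] by metis
  have val: "f i = (\<sigma> ^^ (i div N)) (f (i mod N))" if "f \<in> shift_sequences N \<sigma> X" for f i
    using shift_sequences_step[of f N \<sigma> "i mod N" "i div N"] that by (simp add: shift_sequences_def)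
  \<comment> \<open>The orbits of the \<open>N\<close> entries have \<open>k\<close> elements each
    and \<open>card X = N * k\<close>, so they cover \<open>X\<close> exactly when no two
    coincide.\<close>
  have cover: "(\<Union>y\<in>set xs. ?o y) = X \<longleftrightarrow> distinct (map ?o xs)"
    if "length xs = N" "set xs \<subseteq> X" for xs
  proof -
    have sub: "(\<Union>y\<in>set xs. ?o y) \<subseteq> X" using permutes_orbit_subset[OF p] that by blast
    have "(\<Union>y\<in>set xs. ?o y) = X \<longleftrightarrow> card (\<Union>y\<in>set xs. ?o y) = N * k"
      using card_subset_eq[OF X(1) sub] X(2) by metis
    also have "\<dots> \<longleftrightarrow> card (?o ` set xs) = N"
      using card_orbits_mult[OF s k X(1) that(2)] k by (simp add: mult.commute)
    also have "\<dots> \<longleftrightarrow> distinct (map ?o xs)"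
      using that(1) card_distinct[of "map ?o xs"] distinct_card[of "map ?o xs"] by auto
    finally show ?thesis .
  qed
  have "bij_betw (\<lambda>f. map f [0..<N]) (shift_sequences N \<sigma> X) (transversals \<sigma> X N)"
  proof (rule bij_betw_imageI)
    show "inj_on (\<lambda>f. map f [0..<N]) (shift_sequences N \<sigma> X)"
    proof (rule inj_onI)
      fix f g assume f: "f \<in> shift_sequences N \<sigma> X" and g: "g \<in> shift_sequences N \<sigma> X"
        and "map f [0..<N] = map g [0..<N]"
      then have "\<And>i. i < N \<Longrightarrow> f i = g i" by simp
      then have "f (i mod N) = g (i mod N)" for i using N by simp
      then show "f = g" using val[OF f] val[OF g] by (metis ext)
    qed
    show "(\<lambda>f. map f [0..<N]) ` shift_sequences N \<sigma> X = transversals \<sigma> X N"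
    proof (intro equalityI subsetI)
      fix xs assume "xs \<in> (\<lambda>f. map f [0..<N]) ` shift_sequences N \<sigma> X"
      then obtain f where f: "f \<in> shift_sequences N \<sigma> X" and xs: "xs = map f [0..<N]" by blast
      have r: "range f = X" using f by (simp add: shift_sequences_def)
      have "X \<subseteq> (\<Union>y\<in>set xs. ?o y)"
      proof
        fix x assume "x \<in> X"
        then obtain i where "x = f i" using r by blast
        then have "x \<in> ?o (f (i mod N))" using val[OF f, of i] unfolding o by auto
        moreover have "f (i mod N) \<in> set xs" using N by (simp add: xs)
        ultimately show "x \<in> (\<Union>y\<in>set xs. ?o y)" by blast
      qed
      moreover have sub: "set xs \<subseteq> X" using r xs by auto
      ultimately have "(\<Union>y\<in>set xs. ?o y) = X" using permutes_orbit_subset[OF p] by blast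
      then show "xs \<in> transversals \<sigma> X N"
        using cover[of xs] sub by (simp add: transversals_def xs)
    next
      fix xs assume "xs \<in> transversals \<sigma> X N"
      then have xs: "length xs = N" "set xs \<subseteq> X" "distinct (map ?o xs)"
        by (auto simp: transversals_def)
      \<comment> \<open>Inverse of the restriction: the remainder selects a representative and the
        quotient says how often to apply \<open>\<sigma>\<close>.\<close>
      define f where "f i = (\<sigma> ^^ (i div N)) (xs ! (i mod N))" for i
      have "range f = X"
      proof (intro equalityI subsetI)
        fix x assume "x \<in> range f"
        then obtain i where i: "x = f i" by blast
        have "xs ! (i mod N) \<in> X" using xs N by (metis mod_less_divisor nth_mem subsetD)
        then show "x \<in> X" unfolding i f_def using permutes_in_funpow_image[OF p] by blast
      next
        fix x assume "x \<in> X"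
        then obtain y where "y \<in> set xs" "x \<in> ?o y" using cover[OF xs(1,2)] xs(3) by blast
        then obtain i j where "i < N" "x = (\<sigma> ^^ j) (xs ! i)"
          unfolding o using xs(1) by (auto simp: in_set_conv_nth)
        then have "x = f (i + j * N)" by (simp add: f_def)
        then show "x \<in> range f" by blast
      qed
      moreover have "f (i + N) = \<sigma> (f i)" for i using N by (simp add: f_def)
      ultimately have "f \<in> shift_sequences N \<sigma> X" by (simp add: shift_sequences_def)
      moreover have "xs = map f [0..<N]"
        by (rule nth_equalityI) (auto simp: xs f_def)
      ultimately show "xs \<in> (\<lambda>f. map f [0..<N]) ` shift_sequences N \<sigma> X" by blast
    qed
  qed
  then show ?thesis
    using bij_betw_same_card card_transversals[OF s k X] prod_diff_mult_eq_fact by metis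
qed

section \<open>Periodic listings and their shifts\<close>

definition cyclic_listings :: "'a set \<Rightarrow> (nat \<Rightarrow> 'a) set" where
  "cyclic_listings X = {f. range f = X \<and> (\<forall>i. f (i + card X) = f i)}"

text \<open>One period already runs through \<open>X\<close> and has \<open>card X\<close> indices,
  so it has no repetitions.\<close>

lemma cyclic_listings_eq_iff:
  assumes "f \<in> cyclic_listings X" and X: "finite X"
  shows "f i = f j \<longleftrightarrow> i mod card X = j mod card X"
proof -
  have r: "range f = X" and per: "\<forall>i. f (i + card X) = id (f i)"
    using assms(1) by (auto simp: cyclic_listings_def)
  have pos: "card X > 0" using X r by (auto simp: card_gt_0_iff)
  have m: "f i = f (i mod card X)" for i
    using shift_sequences_step[where \<sigma> = id, OF per, of "i mod card X" "i div card X"] by simp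
  have "X \<subseteq> f ` {..<card X}"
  proof
    fix x assume "x \<in> X"
    then obtain i where "x = f i" using r by blast
    then show "x \<in> f ` {..<card X}" using m[of i] pos by (intro image_eqI[of _ _ "i mod card X"]) auto
  qed
  then have "f ` {..<card X} = X" using r by blast
  then have "inj_on f {..<card X}" by (intro eq_card_imp_inj_on) auto
  then show ?thesis using m pos by (metis inj_onD lessThan_iff mod_less_divisor)
qed

text \<open>At \<open>x = f i\<close>, applying \<open>\<sigma>\<close> \<open>j\<close> times
  advances the index by \<open>j * N\<close>. As values repeat exactly at multiples of
  \<open>N * k\<close>, this returns to \<open>x\<close> iff \<open>k\<close> divides
  \<open>j\<close>.\<close>

lemma cyclic_listings_semiregular:
  assumes f: "f \<in> cyclic_listings X" and X: "finite X" "card X = N * k" and N: "N > 0"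
    and p: "\<sigma> permutes X" and st: "\<forall>i. f (i + N) = \<sigma> (f i)"
  shows "semiregular k \<sigma> X"
  unfolding semiregular_def
proof (intro conjI ballI allI)
  fix x j assume "x \<in> X"
  then obtain i where x: "x = f i" using f by (auto simp: cyclic_listings_def)
  have "(\<sigma> ^^ j) x = x \<longleftrightarrow> f (i + j * N) = f i"
    using shift_sequences_step[OF st] x by simp
  also have "\<dots> \<longleftrightarrow> N * k dvd (i + j * N) - i"
    unfolding cyclic_listings_eq_iff[OF f X(1)] X(2) by (rule mod_eq_dvd_iff_nat) simp
  also have "\<dots> \<longleftrightarrow> k dvd j" using N by (simp add: mult.commute)
  finally show "(\<sigma> ^^ j) x = x \<longleftrightarrow> k dvd j" .
qed (rule p)

text \<open>The shift is well defined on values because equal values sit at congruent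
  indices.\<close>

lemma cyclic_listings_shift_exists:
  assumes f: "f \<in> cyclic_listings X" and X: "finite X"
  shows "\<exists>\<sigma>. \<sigma> permutes X \<and> (\<forall>i. f (i + N) = \<sigma> (f i))"
proof -
  have r: "range f = X" and per: "\<forall>i. f (i + card X) = id (f i)"
    using f by (auto simp: cyclic_listings_def)
  have pos: "card X > 0" using X r by (auto simp: card_gt_0_iff)
  define \<sigma> where "\<sigma> x = (if x \<in> X then f ((SOME i. f i = x) + N) else x)" for x
  have st: "f (i + N) = \<sigma> (f i)" for i
  proof -
    have "f (SOME j. f j = f i) = f i" by (rule someI) (rule refl)
    then have "f ((SOME j. f j = f i) + N) = f (i + N)"
      unfolding cyclic_listings_eq_iff[OF f X] by (metis mod_add_left_eq)
    then show ?thesis using r by (auto simp: \<sigma>_def)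
  qed
  have "\<sigma> ` X = X"
  proof (intro equalityI subsetI)
    fix x assume "x \<in> \<sigma> ` X" then show "x \<in> X" using r st[symmetric] by auto
  next
    fix x assume "x \<in> X"
    then obtain i where x: "x = f i" using r by blast
    \<comment> \<open>Since \<open>N * card X\<close> is a multiple of the period, advancing by
      \<open>N * (card X - 1)\<close> replaces stepping back by \<open>N\<close> and yields a
      preimage of \<open>x\<close>.\<close>
    have "f (i + N * card X) = f i" using shift_sequences_step[where \<sigma> = id, OF per] by simp
    also have "i + N * card X = (i + N * (card X - 1)) + N"
      using pos by (cases "card X") auto
    finally have "x = \<sigma> (f (i + N * (card X - 1)))" unfolding st x ..
    then show "x \<in> \<sigma> ` X" using r by blast
  qed
  then have "\<sigma> permutes X"
    using X by (intro bij_imp_permutes) (auto simp: bij_betw_def eq_card_imp_inj_on \<sigma>_def)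
  then show ?thesis using st by blast
qed

lemma cyclic_listings_shift_unique:
  assumes "f \<in> cyclic_listings X" and "\<sigma> permutes X" "\<tau> permutes X"
    and "\<forall>i. f (i + N) = \<sigma> (f i)" "\<forall>i. f (i + N) = \<tau> (f i)"
  shows "\<sigma> = \<tau>"
proof
  fix x show "\<sigma> x = \<tau> x"
  proof (cases "x \<in> X")
    case True
    then obtain i where "x = f i" using assms(1) by (auto simp: cyclic_listings_def)
    then show ?thesis using assms(4,5) by metis
  next
    case False
    then show ?thesis using assms(2,3) by (simp add: permutes_not_in)
  qed
qed

text \<open>Advancing by \<open>card X = N * k\<close> applies \<open>\<sigma>\<close> exactly
  \<open>k\<close> times, which is the identity on \<open>X\<close>; hence these sequences are
  periodic.\<close>

lemma shift_sequences_eq_cyclic_listings: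
  assumes "semiregular k \<sigma> X" "card X = N * k"
  shows "shift_sequences N \<sigma> X = {f \<in> cyclic_listings X. \<forall>i. f (i + N) = \<sigma> (f i)}"
proof -
  have "f (i + card X) = f i" if "f \<in> shift_sequences N \<sigma> X" for f i
  proof -
    have "f (i + k * N) = (\<sigma> ^^ k) (f i)"
      using that by (intro shift_sequences_step) (simp add: shift_sequences_def)
    moreover have "f i \<in> X" using that by (auto simp: shift_sequences_def)
    ultimately show ?thesis using assms by (simp add: semiregular_def mult.commute)
  qed
  then show ?thesis by (auto simp: shift_sequences_def cyclic_listings_def)
qed

lemma finite_semiregular: "finite X \<Longrightarrow> finite {\<sigma>. semiregular k \<sigma> X}"
  by (rule finite_subset[OF _ finite_permutations[of X]]) (auto simp: semiregular_def)

text \<open>Each listing has exactly one permutation as its shift by \<open>N\<close>, and that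
  permutation is semiregular; the fibres are the shift sequences.\<close>

lemma card_cyclic_listings_semiregular:
  assumes X: "finite X" "card X = N * k" and "N > 0" "k > 0"
  shows "card (cyclic_listings X) = card {\<sigma>. semiregular k \<sigma> X} * (fact N * k ^ N)"
proof (rule card_fibres_eq[where Q = "\<lambda>\<sigma> f. \<forall>i. f (i + N) = \<sigma> (f i)"])
  fix \<sigma> assume "\<sigma> \<in> {\<sigma>. semiregular k \<sigma> X}"
  then have "semiregular k \<sigma> X" by simp
  then show "card {f \<in> cyclic_listings X. \<forall>i. f (i + N) = \<sigma> (f i)} = fact N * k ^ N"
    using shift_sequences_eq_cyclic_listings[of k \<sigma> X N] card_shift_sequences[of k \<sigma> X N] assms by simp
next
  fix f assume f: "f \<in> cyclic_listings X"
  then obtain \<sigma> where "\<sigma> permutes X" "\<forall>i. f (i + N) = \<sigma> (f i)"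
    using cyclic_listings_shift_exists[OF _ X(1)] by blast
  moreover from this have "semiregular k \<sigma> X"
    using cyclic_listings_semiregular[OF f X assms(3)] by blast
  ultimately show "\<exists>!\<sigma>. \<sigma> \<in> {\<sigma>. semiregular k \<sigma> X} \<and> (\<forall>i. f (i + N) = \<sigma> (f i))"
    using cyclic_listings_shift_unique[OF f] by (auto simp: semiregular_def)
qed (use assms finite_semiregular in auto)

text \<open>The case \<open>k = 1\<close> of the previous count: only \<open>id\<close> has all
  cycles of length one.\<close>

lemma card_cyclic_listings:
  assumes "finite X" "X \<noteq> {}"
  shows "card (cyclic_listings X) = fact (card X)"
proof -
  have "{\<sigma>. semiregular 1 \<sigma> X} = {id}"
  proof -
    have "\<sigma> = id" if s: "semiregular 1 \<sigma> X" for \<sigma>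
    proof
      fix x
      have "(\<sigma> ^^ 1) x = x" if "x \<in> X"
        using that s by (simp only: semiregular_def one_dvd)
      then show "\<sigma> x = id x"
        using s by (cases "x \<in> X") (auto simp: semiregular_def permutes_not_in)
    qed
    then show ?thesis by (auto simp: semiregular_def permutes_id)
  qed
  then show ?thesis
    using card_cyclic_listings_semiregular[of X "card X" 1] assms by (auto simp: card_gt_0_iff)
qed

lemma card_semiregular:
  assumes "finite X" "card X = N * k" and "N > 0" "k > 0"
  shows "card {\<sigma>. semiregular k \<sigma> X} * (fact N * k ^ N) = fact (card X)"
proof -
  have "X \<noteq> {}" using assms by auto
  then show ?thesis using card_cyclic_listings card_cyclic_listings_semiregular assms by metis
qed

text \<open>An orbit of size \<open>card X\<close> fills \<open>X\<close>; conversely, on a single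
  cycle the first return time of every point is the size of the orbit.\<close>

lemma rotation_iff_semiregular:
  assumes "finite X" "X \<noteq> {}"
  shows "r permutes X \<and> cyclic_on r X \<longleftrightarrow> semiregular (card X) r X"
proof
  assume s: "semiregular (card X) r X"
  then have p: "r permutes X" by (simp add: semiregular_def)
  obtain x where x: "x \<in> X" using assms(2) by blast
  have "Orbits.orbit r x = X"
    using semiregular_orbit(2)[OF s _ x] permutes_orbit_subset[OF p x] assms
    by (metis card_gt_0_iff card_subset_eq)
  then show "r permutes X \<and> cyclic_on r X" using p x by (auto simp: cyclic_on_def)
next
  assume a: "r permutes X \<and> cyclic_on r X"
  have "(r ^^ j) x = x \<longleftrightarrow> card X dvd j" if x: "x \<in> X" for x j
  proof -
    have o: "Orbits.orbit r x = X" using orbit_cyclic_eq3[of r X x] a x by simp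
    let ?p = "funpow_dist1 r x x"
    have self: "x \<in> Orbits.orbit r x" using o x by simp
    \<comment> \<open>The powers below the first return time \<open>?p\<close> enumerate the orbit
      without repetition.\<close>
    have c: "card X = ?p"
      using orbit_conv_funpow_dist1[OF self] inj_on_funpow_dist1[OF self] o
      by (metis card_atLeastLessThan card_image diff_zero)
    have px: "(r ^^ ?p) x = x" by (rule funpow_dist1_prop[OF self])
    have "(r ^^ j) x = (r ^^ (j mod ?p)) x" using funpow_mod_eq[OF px] by metis
    moreover have "j mod ?p < ?p" by simp
    ultimately have "(r ^^ j) x = x \<longleftrightarrow> j mod ?p = 0"
      using funpow_dist1_least[of "j mod ?p" r x x] by (cases "j mod ?p = 0") auto
    then show ?thesis unfolding c by (simp add: mod_eq_0_iff_dvd)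
  qed
  then show "semiregular (card X) r X" using a by (simp add: semiregular_def)
qed

section \<open>Moebius inversion over divisors\<close>

lemma prod_prime_factors_squarefree:
  fixes e :: nat
  assumes "squarefree e"
  shows "\<Prod>(prime_factors e) = e"
proof -
  have "e \<noteq> 0" using assms by (metis not_squarefree_0)
  have "\<Prod>(prime_factors e) = (\<Prod>p\<in>prime_factors e. p ^ multiplicity p e)"
  proof (rule prod.cong[OF refl])
    fix p assume p: "p \<in> prime_factors e"
    then have "multiplicity p e \<le> 1"
      using assms squarefree_factorial_semiring''[OF \<open>e \<noteq> 0\<close>] by auto
    moreover have "multiplicity p e > 0" using p by (simp add: prime_factors_multiplicity)
    ultimately have "multiplicity p e = 1" by simp
    then show "p = p ^ multiplicity p e" by simp
  qed
  also have "\<dots> = e" using prod_prime_factors[OF \<open>e \<noteq> 0\<close>] by simp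
  finally show ?thesis .
qed

lemma prime_factors_prod_primes:
  fixes S :: "nat set"
  assumes "finite S" and "\<And>p. p \<in> S \<Longrightarrow> prime p"
  shows "prime_factors (\<Prod>S) = S"
proof -
  have "0 \<notin> (\<lambda>p. p) ` S" using assms(2)[of 0] by auto
  then have "prime_factors (\<Prod>S) = (\<Union>p\<in>S. prime_factors p)"
    using prime_factors_prod[OF assms(1), of "\<lambda>p. p"] by (simp add: comp_def)
  also have "\<dots> = S" using assms(2) by (simp add: prime_prime_factors)
  finally show ?thesis .
qed

text \<open>Squarefree divisors correspond to sets of prime factors, and the alternating sum over
  these sets expands a product of factors \<open>1 - 1\<close>, which is empty exactly for
  \<open>n = 1\<close>.\<close>

lemma sum_moebius_mu_divisors:
  assumes "n > 0"
  shows "(\<Sum>e | e dvd n. moebius_mu e) = (if n = 1 then 1 else 0)"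
proof -
  let ?P = "prime_factors n"
  have "(\<Sum>e | e dvd n. moebius_mu e)
      = (\<Sum>e | e dvd n \<and> squarefree e. (-1) ^ card (prime_factors e))"
    using assms by (intro sum.mono_neutral_cong_right) (auto simp: moebius_mu_def)
  also have "\<dots> = (\<Sum>S\<in>Pow ?P. (-1) ^ card S)"
  proof (rule sum.reindex_bij_witness[where i = "\<lambda>S. \<Prod>S" and j = prime_factors])
    fix e assume e: "e \<in> {e. e dvd n \<and> squarefree e}"
    then show "\<Prod>(prime_factors e) = e" by (simp add: prod_prime_factors_squarefree)
    show "prime_factors e \<in> Pow ?P" using e assms dvd_prime_factors[of n e] by auto
  next
    fix S assume "S \<in> Pow ?P"
    then have fin: "finite S" and pr: "\<And>p. p \<in> S \<Longrightarrow> prime p" and sub: "S \<subseteq> ?P"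
      by (auto intro: finite_subset)
    show "prime_factors (\<Prod>S) = S" by (rule prime_factors_prod_primes[OF fin pr])
    have "squarefree (\<Prod>S)"
      using pr by (intro squarefree_prod_coprime) (auto simp: primes_coprime intro: squarefree_prime)
    moreover have "\<Prod>S dvd n"
    proof -
      have "\<Prod>S dvd \<Prod>?P" using sub by (intro prod_dvd_prod_subset) auto
      also have "\<Prod>?P dvd (\<Prod>p\<in>?P. p ^ multiplicity p n)"
        by (rule prod_dvd_prod) (auto simp: prime_factors_multiplicity)
      also have "\<dots> = n" using assms prod_prime_factors[of n] by simp
      finally show ?thesis .
    qed
    ultimately show "\<Prod>S \<in> {e. e dvd n \<and> squarefree e}" by simp
  qed auto
  also have "\<dots> = (\<Prod>p\<in>?P. 1 - 1)"
    by (subst prod_diff_conv_sum) auto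
  also have "\<dots> = (if n = 1 then 1 else 0)"
  proof (cases "n = 1")
    case False
    then have "?P \<noteq> {}" using assms by (simp add: prime_factorization_empty_iff)
    then show ?thesis using False by (simp add: card_gt_0_iff)
  qed simp
  finally show ?thesis .
qed

text \<open>Writing \<open>k = d * e\<close> reduces this to the divisors of \<open>s div d\<close>;
  if \<open>d\<close> does not divide \<open>s\<close>, the index set is empty.\<close>

lemma sum_moebius_mu_between:
  assumes "d > 0" and "s > 0"
  shows "(\<Sum>k | d dvd k \<and> k dvd s. moebius_mu (k div d)) = (if s = d then 1 else 0)"
proof (cases "d dvd s")
  case True
  then obtain t where s: "s = d * t" by blast
  then have "t > 0" using assms(2) by simp
  have "(\<Sum>k | d dvd k \<and> k dvd s. moebius_mu (k div d)) = (\<Sum>e | e dvd t. moebius_mu e)"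
    using assms(1) s
    by (intro sum.reindex_bij_witness[where i = "\<lambda>e. d * e" and j = "\<lambda>k. k div d"]) auto
  also have "\<dots> = (if s = d then 1 else 0)"
    unfolding sum_moebius_mu_divisors[OF \<open>t > 0\<close>] using s assms(1) by simp
  finally show ?thesis .
next
  case False
  then have "{k. d dvd k \<and> k dvd s} = {}" by (auto dest: dvd_trans)
  with False show ?thesis by (simp only:) auto
qed

section \<open>Maps and their automorphisms\<close>

text \<open>The analogue in the natural numbers of a nonzero subgroup of the integers: closure under
  remainders shows that the least positive element generates.\<close>

lemma closed_diff_multiples:
  fixes J :: "nat set"
  assumes "0 \<in> J" "p \<in> J" "p > 0"
    and add: "\<And>i j. i \<in> J \<Longrightarrow> j \<in> J \<Longrightarrow> i + j \<in> J"
    and diff: "\<And>i j. i \<in> J \<Longrightarrow> i + j \<in> J \<Longrightarrow> j \<in> J"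
  shows "\<exists>g>0. J = {j. g dvd j}"
proof -
  define g where "g = (LEAST g. g \<in> J \<and> g > 0)"
  have g: "g \<in> J \<and> g > 0" unfolding g_def using assms(2,3) by (intro LeastI) blast
  have mult: "q * g \<in> J" for q
    by (induction q) (auto simp: assms(1) intro: add g[THEN conjunct1])
  have "g dvd j" if "j \<in> J" for j
  proof -
    have "j mod g \<in> J" using diff[of "j div g * g" "j mod g"] mult that by simp
    moreover have "j mod g < g" using g by simp
    ultimately have "j mod g = 0"
      using not_less_Least[of "j mod g" "\<lambda>g. g \<in> J \<and> g > 0"] by (simp flip: g_def)
    then show ?thesis by (simp add: mod_eq_0_iff_dvd)
  qed
  moreover have "j \<in> J" if "g dvd j" for j using that mult by (auto simp: dvd_def mult.commute)
  ultimately show ?thesis using g by blast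
qed

lemma funpow_permutes: "r permutes X \<Longrightarrow> (r ^^ j) permutes X"
  by (induction j) (auto simp: permutes_id permutes_compose)

lemma semiregular_funpow_id:
  assumes "semiregular k \<sigma> X" and "k dvd j"
  shows "\<sigma> ^^ j = id"
proof
  fix x show "(\<sigma> ^^ j) x = id x"
    using assms funpow_permutes[of \<sigma> X j]
    by (cases "x \<in> X") (auto simp: semiregular_def permutes_not_in)
qed

text \<open>A suitable power of \<open>r\<close> agrees with \<open>\<tau>\<close> at one point;
  commuting with \<open>r\<close> carries the agreement along its single cycle.\<close>

lemma cyclic_commute_power:
  assumes r: "semiregular (card X) r X" and X: "finite X" "X \<noteq> {}"
    and t: "\<tau> permutes X" and comm: "\<tau> \<circ> r = r \<circ> \<tau>"
  shows "\<exists>j. \<tau> = r ^^ j"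
proof -
  obtain x where x: "x \<in> X" using X by blast
  have "r permutes X \<and> cyclic_on r X" using rotation_iff_semiregular[OF X] r by blast
  then have p: "r permutes X" and "Orbits.orbit r x = X"
    using orbit_cyclic_eq3[of r X x] x by auto
  then have o: "X = {(r ^^ i) x |i. True}"
    using orbit_altdef_self_in[of x r] x by simp
  have "\<tau> x \<in> X" using t x by (simp add: permutes_in_image)
  then obtain j where j: "\<tau> x = (r ^^ j) x" using o by blast
  have c: "\<tau> ((r ^^ i) y) = (r ^^ i) (\<tau> y)" for i y
    using comm by (induction i) (auto simp: fun_eq_iff)
  have "\<tau> y = (r ^^ j) y" for y
  proof (cases "y \<in> X")
    case True
    then obtain i where i: "y = (r ^^ i) x" using o by blast
    have "\<tau> y = (r ^^ (i + j)) x" unfolding i c j by (simp add: funpow_add)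
    also have "\<dots> = (r ^^ j) y" unfolding i by (simp only: add.commute[of i j] funpow_add comp_apply)
    finally show ?thesis .
  next
    case False
    then show ?thesis using permutes_not_in[OF t] permutes_not_in[OF funpow_permutes[OF p]] by simp
  qed
  then show ?thesis by blast
qed

section \<open>Loop permutations acting on the neighbours of the centre\<close>

lemma lift_perm_funpow: "lift_perm (\<sigma> ^^ j) = lift_perm \<sigma> ^^ j"
  by (induction j) (simp_all only: funpow.simps lift_perm_id lift_perm_comp)

lemma nbhd_Center: "nbhd n Center = Black ` {1..n} \<union> White ` {1..n}"
  by (auto simp: nbhd_def edge_iff)

lemma card_nbhd_Center: "card (nbhd n Center) = 2 * n"
  unfolding nbhd_Center by (subst card_Un_disjoint) (auto simp: card_image inj_on_def)

lemma finite_nbhd_Center: "finite (nbhd n Center)"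
  by (simp add: nbhd_Center)

lemma nbhd_Center_nonempty: "n \<ge> 1 \<Longrightarrow> nbhd n Center \<noteq> {}"
  by (auto simp: nbhd_Center)

lemma lift_perm_permutes_nbhd:
  assumes "\<sigma> permutes {1..n}"
  shows "lift_perm \<sigma> permutes nbhd n Center"
proof (rule bij_fixing_permutes)
  show "bij (lift_perm \<sigma>)" by (rule lift_perm_bij[OF assms])
  fix x assume "x \<notin> nbhd n Center"
  then show "lift_perm \<sigma> x = x"
    using permutes_not_in[OF assms] by (cases x) (auto simp: nbhd_Center image_iff)
qed

text \<open>The lift acts on the neighbours as two copies of \<open>\<sigma>\<close>, one for each
  colour, so cycle lengths are unchanged.\<close>

lemma semiregular_lift_perm_iff:
  assumes "\<sigma> permutes {1..n}"
  shows "semiregular k (lift_perm \<sigma>) (nbhd n Center) \<longleftrightarrow> semiregular k \<sigma> {1..n}"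
  using lift_perm_permutes_nbhd[OF assms] assms
  by (simp add: semiregular_def nbhd_Center ball_Un flip: lift_perm_funpow)

lemma nbhd_not_Center:
  assumes "v \<in> bouquet_verts n" "v \<noteq> Center"
  shows "finite (nbhd n v)" "card (nbhd n v) = 2"
proof -
  obtain i where i: "i \<in> {1..n}" "v = Black i \<or> v = White i"
    using assms by (auto simp: bouquet_verts_def)
  then have "nbhd n v = (if v = Black i then {Center, White i} else {Center, Black i})"
    by (auto simp: nbhd_def edge_iff)
  then show "finite (nbhd n v)" "card (nbhd n v) = 2" by auto
qed

lemma rotation_at_iff_semiregular:
  assumes "n \<ge> 1" and "v \<in> bouquet_verts n"
  shows "rotation_at n v r \<longleftrightarrow> semiregular (card (nbhd n v)) r (nbhd n v)"
proof -
  have "finite (nbhd n v) \<and> nbhd n v \<noteq> {}"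
    using nbhd_not_Center[OF assms(2)] finite_nbhd_Center nbhd_Center_nonempty[OF assms(1)]
    by (cases "v = Center") auto
  then show ?thesis unfolding rotation_at_def by (intro rotation_iff_semiregular) auto
qed

text \<open>A two-element neighbourhood carries a single cyclic permutation, the transposition; this
  is \<open>card_semiregular\<close> with one cycle of length 2.\<close>

lemma rotation_at_not_Center_unique:
  assumes "n \<ge> 1" and "v \<in> bouquet_verts n" "v \<noteq> Center"
  shows "\<exists>!r. rotation_at n v r"
proof -
  have "card {r. semiregular 2 r (nbhd n v)} * (fact 1 * 2 ^ 1) = fact (card (nbhd n v))"
    using nbhd_not_Center[OF assms(2,3)] by (intro card_semiregular) auto
  then have "card {r. rotation_at n v r} = 1"
    using nbhd_not_Center[OF assms(2,3)] rotation_at_iff_semiregular[OF assms(1,2)]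
    by (simp add: fact_numeral)
  then obtain r where "{r. rotation_at n v r} = {r}" using card_1_singletonE by blast
  then show ?thesis by (metis mem_Collect_eq singletonD singletonI)
qed

text \<open>Rotations at the coloured vertices are forced, so the one at the centre is a free choice
  and determines the map.\<close>

lemma bij_betw_rotation_Center:
  assumes "n \<ge> 1"
  shows "bij_betw (\<lambda>\<rho>. \<rho> Center) (bouquet_maps n)
           {r. semiregular (2 * n) r (nbhd n Center)}"
proof (rule bij_betw_imageI)
  have c: "Center \<in> bouquet_verts n" by (simp add: bouquet_verts_def)
  have iff: "rotation_at n Center r \<longleftrightarrow> semiregular (2 * n) r (nbhd n Center)" for r
    using rotation_at_iff_semiregular[OF assms c] by (simp add: card_nbhd_Center)
  show "inj_on (\<lambda>\<rho>. \<rho> Center) (bouquet_maps n)"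
  proof (intro inj_onI ext)
    fix \<rho> \<rho>' v assume "\<rho> \<in> bouquet_maps n" "\<rho>' \<in> bouquet_maps n" "\<rho> Center = \<rho>' Center"
    then have "\<rho> v = \<rho>' v"
      using rotation_at_not_Center_unique[OF assms, of v] unfolding bouquet_maps_def
      by (cases "v \<in> bouquet_verts n"; cases "v = Center") auto
    then show "\<rho> v x = \<rho>' v x" for x by simp
  qed
  show "(\<lambda>\<rho>. \<rho> Center) ` bouquet_maps n = {r. semiregular (2 * n) r (nbhd n Center)}"
  proof (intro equalityI subsetI)
    fix r assume r: "r \<in> {r. semiregular (2 * n) r (nbhd n Center)}"
    define \<rho> where "\<rho> v = (if v = Center then r else if v \<in> bouquet_verts n
      then THE s. rotation_at n v s else id)" for v
    have "rotation_at n v (\<rho> v)" if "v \<in> bouquet_verts n" for v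
      using theI'[OF rotation_at_not_Center_unique[OF assms that]] r that
      by (auto simp: \<rho>_def iff)
    then have "\<rho> \<in> bouquet_maps n" using c by (auto simp: bouquet_maps_def \<rho>_def)
    moreover have "r = \<rho> Center" by (simp add: \<rho>_def)
    ultimately show "r \<in> (\<lambda>\<rho>. \<rho> Center) ` bouquet_maps n" by blast
  qed (use c in \<open>auto simp: bouquet_maps_def iff\<close>)
qed

text \<open>The lift fixes the centre, whose rotation determines the map, so invariance has to be
  tested only there, where the action is conjugation.\<close>

lemma map_action_fixed_iff:
  assumes "n \<ge> 1" and s: "\<sigma> permutes {1..n}" and \<rho>: "\<rho> \<in> bouquet_maps n"
  shows "map_action n \<sigma> \<rho> = \<rho> \<longleftrightarrow> lift_perm \<sigma> \<circ> \<rho> Center = \<rho> Center \<circ> lift_perm \<sigma>"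
proof -
  let ?f = "lift_perm \<sigma>"
  have "map_action n \<sigma> \<rho> = \<rho> \<longleftrightarrow> map_action n \<sigma> \<rho> Center = \<rho> Center"
    using bij_betw_rotation_Center[OF assms(1)] map_action_closed[OF s \<rho>] \<rho>
    by (metis bij_betw_def inj_onD)
  also have "map_action n \<sigma> \<rho> Center = ?f \<circ> \<rho> Center \<circ> inv' ?f"
    using \<rho> lift_perm_bij(2)[OF s] by (simp add: map_action_def)
  also have "\<dots> = \<rho> Center \<longleftrightarrow> ?f \<circ> \<rho> Center = \<rho> Center \<circ> ?f"
    using lift_perm_bij(1)[OF s]
    by (metis bij_is_inj bij_is_surj comp_assoc comp_id inv_o_cancel surj_iff)
  finally show ?thesis .
qed

lemma map_automorphism_group_eq:
  assumes n: "n \<ge> 1" and \<rho>: "\<rho> \<in> bouquet_maps n"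
  shows "map_automorphism_group n \<rho>
    = {\<sigma>. \<sigma> permutes {1..n} \<and> (\<exists>j. lift_perm \<sigma> = \<rho> Center ^^ j)}"
proof -
  have r: "semiregular (card (nbhd n Center)) (\<rho> Center) (nbhd n Center)"
    using bij_betwE[OF bij_betw_rotation_Center[OF n]] \<rho> by (simp add: card_nbhd_Center)
  have "lift_perm \<sigma> \<circ> \<rho> Center = \<rho> Center \<circ> lift_perm \<sigma> \<longleftrightarrow> (\<exists>j. lift_perm \<sigma> = \<rho> Center ^^ j)"
    if s: "\<sigma> permutes {1..n}" for \<sigma>
    using cyclic_commute_power[OF r finite_nbhd_Center nbhd_Center_nonempty[OF n]
        lift_perm_permutes_nbhd[OF s]]
    by (auto simp: fun_eq_iff funpow_swap1)
  then show ?thesis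
    using map_action_fixed_iff[OF n _ \<rho>]
    by (auto simp: map_automorphism_group_def stabilizer_def sym_group_carrier)
qed

text \<open>The exponents for which a power of the rotation at the centre is a lift are the
  multiples of some \<open>g\<close>. With \<open>2 * n = g * s\<close>, the loop permutation
  lifting to the \<open>g\<close>-th power generates the group and has order \<open>s\<close>. The
  last conclusion is the divisibility test used for counting.\<close>

lemma map_automorphism_group_cyclic:
  assumes n: "n \<ge> 1" and \<rho>: "\<rho> \<in> bouquet_maps n"
  obtains \<sigma> s where "semiregular s \<sigma> {1..n}" "s > 0" "s dvd n"
    "map_automorphism_group n \<rho> = range (\<lambda>q. \<sigma> ^^ q)"
    "card (map_automorphism_group n \<rho>) = s"
    "\<And>k m. k * m = n \<Longrightarrow> k dvd s \<longleftrightarrow> (\<exists>\<tau>. \<tau> permutes {1..n} \<and> lift_perm \<tau> = \<rho> Center ^^ (2 * m))"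
proof -
  let ?r = "\<rho> Center"
  have r: "semiregular (2 * n) ?r (nbhd n Center)"
    using bij_betwE[OF bij_betw_rotation_Center[OF n]] \<rho> by blast
  then have p: "?r permutes nbhd n Center" by (simp add: semiregular_def)
  define J where "J = {j. \<exists>\<tau>. \<tau> permutes {1..n} \<and> lift_perm \<tau> = ?r ^^ j}"
  have J0: "j \<in> J" if "2 * n dvd j" for j
    unfolding J_def using semiregular_funpow_id[OF r that] lift_perm_id
    by (intro CollectI exI[of _ id]) (simp add: permutes_id)
  have Jadd: "i + j \<in> J" if ij: "i \<in> J" "j \<in> J" for i j
  proof -
    obtain a b where "a permutes {1..n}" "lift_perm a = ?r ^^ i"
      "b permutes {1..n}" "lift_perm b = ?r ^^ j" using ij unfolding J_def by blast
    then have "(a \<circ> b) permutes {1..n}" "lift_perm (a \<circ> b) = ?r ^^ (i + j)"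
      by (auto simp: permutes_compose lift_perm_comp funpow_add)
    then show ?thesis unfolding J_def by blast
  qed
  have Jdiff: "j \<in> J" if ij: "i \<in> J" "i + j \<in> J" for i j
  proof -
    obtain a b where a: "a permutes {1..n}" "lift_perm a = ?r ^^ i"
      and b: "b permutes {1..n}" "lift_perm b = ?r ^^ (i + j)" using ij unfolding J_def by blast
    have "lift_perm (inv' a \<circ> b) = inv' (lift_perm a) \<circ> (lift_perm a \<circ> ?r ^^ j)"
      using a b lift_perm_bij(2)[OF a(1)] by (simp add: lift_perm_comp funpow_add)
    also have "\<dots> = ?r ^^ j"
      using lift_perm_bij(1)[OF a(1)] by (simp add: bij_is_inj flip: comp_assoc)
    finally have "lift_perm (inv' a \<circ> b) = ?r ^^ j" .
    moreover have "(inv' a \<circ> b) permutes {1..n}"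
      using a b by (simp add: permutes_compose permutes_inv)
    ultimately show ?thesis unfolding J_def by blast
  qed
  have "\<exists>g>0. J = {j. g dvd j}"
  proof (rule closed_diff_multiples[of J "2 * n"])
    show "0 \<in> J" "2 * n \<in> J" by (rule J0, simp)+
    show "i + j \<in> J" if "i \<in> J" "j \<in> J" for i j using that by (rule Jadd)
    show "j \<in> J" if "i \<in> J" "i + j \<in> J" for i j using that by (rule Jdiff)
  qed (use n in auto)
  then obtain g where g: "g > 0" "J = {j. g dvd j}" by blast
  have "2 * n \<in> J" by (rule J0) simp
  then obtain s where s: "2 * n = g * s" using g by blast
  have s0: "s > 0" using s n by (cases s) auto
  have "g \<in> J" using g by simp
  then obtain \<sigma> where \<sigma>: "\<sigma> permutes {1..n}" "lift_perm \<sigma> = ?r ^^ g" unfolding J_def by blast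
  have pow: "lift_perm (\<sigma> ^^ q) = ?r ^^ (g * q)" for q
    by (simp add: lift_perm_funpow \<sigma>(2) funpow_mult mult.commute)
  have "semiregular s (lift_perm \<sigma>) (nbhd n Center)"
    unfolding semiregular_def
  proof (intro conjI ballI allI)
    fix x j assume "x \<in> nbhd n Center"
    then have "(lift_perm \<sigma> ^^ j) x = x \<longleftrightarrow> 2 * n dvd g * j"
      using r pow[of j] by (simp add: semiregular_def lift_perm_funpow)
    then show "(lift_perm \<sigma> ^^ j) x = x \<longleftrightarrow> s dvd j" unfolding s using g(1) by simp
  qed (rule lift_perm_permutes_nbhd[OF \<sigma>(1)])
  then have sr: "semiregular s \<sigma> {1..n}" using semiregular_lift_perm_iff[OF \<sigma>(1)] by blast
  have stab: "map_automorphism_group n \<rho> = range (\<lambda>q. \<sigma> ^^ q)"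
  proof (intro equalityI subsetI)
    fix \<tau> assume "\<tau> \<in> map_automorphism_group n \<rho>"
    then obtain j where j: "\<tau> permutes {1..n}" "lift_perm \<tau> = ?r ^^ j"
      unfolding map_automorphism_group_eq[OF n \<rho>] by blast
    then have "g dvd j" using g(2) unfolding J_def by blast
    then obtain q where "lift_perm \<tau> = lift_perm (\<sigma> ^^ q)" using pow j by (metis dvd_def)
    then have "\<tau> = \<sigma> ^^ q" by (rule injD[OF inj_lift_perm])
    then show "\<tau> \<in> range (\<lambda>q. \<sigma> ^^ q)" by blast
  next
    fix \<tau> assume "\<tau> \<in> range (\<lambda>q. \<sigma> ^^ q)"
    then show "\<tau> \<in> map_automorphism_group n \<rho>"
      unfolding map_automorphism_group_eq[OF n \<rho>] using funpow_permutes[OF \<sigma>(1)] pow by blast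
  qed
  have card: "card (map_automorphism_group n \<rho>) = s"
  proof -
    have "range (\<lambda>q. \<sigma> ^^ q) = (\<lambda>q. \<sigma> ^^ q) ` {..<s}"
    proof (intro equalityI subsetI)
      fix \<tau> assume "\<tau> \<in> range (\<lambda>q. \<sigma> ^^ q)"
      then obtain q where "\<tau> = \<sigma> ^^ (q mod s + s * (q div s))" by auto
      also have "\<dots> = \<sigma> ^^ (q mod s)"
        unfolding funpow_add using semiregular_funpow_id[OF sr] by simp
      finally show "\<tau> \<in> (\<lambda>q. \<sigma> ^^ q) ` {..<s}" using s0 by simp
    qed auto
    moreover have "inj_on (\<lambda>q. \<sigma> ^^ q) {..<s}"
    proof (rule inj_onI)
      fix a b assume "a \<in> {..<s}" "b \<in> {..<s}" "\<sigma> ^^ a = \<sigma> ^^ b"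
      then show "a = b" using semiregular_funpow_eq[OF sr, of 1 a b] n by simp
    qed
    ultimately show ?thesis unfolding stab by (simp add: card_image)
  qed
  have "k dvd s \<longleftrightarrow> (\<exists>\<tau>. \<tau> permutes {1..n} \<and> lift_perm \<tau> = ?r ^^ (2 * m))" if km: "k * m = n" for k m
  proof -
    have eq: "g * s = 2 * m * k" using s km by (simp add: mult_ac)
    have k0: "k > 0" using km n by (cases k) auto
    have "(\<exists>\<tau>. \<tau> permutes {1..n} \<and> lift_perm \<tau> = ?r ^^ (2 * m)) \<longleftrightarrow> g dvd 2 * m"
      using g(2) unfolding J_def by blast
    \<comment> \<open>Multiplying by \<open>k\<close> brings in \<open>2 * m * k = g * s\<close>,
      from which \<open>g\<close> can be cancelled.\<close>
    also have "\<dots> \<longleftrightarrow> g * k dvd 2 * m * k" using k0 by simp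
    also have "\<dots> \<longleftrightarrow> k dvd s" unfolding eq[symmetric] using g(1) by simp
    finally show ?thesis by blast
  qed
  moreover have "s dvd n" using semiregular_dvd_card[OF sr s0] by simp
  ultimately show thesis using that sr s0 stab card by blast
qed

text \<open>The group always has a generator whose cycles all have length equal to the group order,
  so only the order remains as a condition.\<close>

lemma d_fold_symmetric_iff:
  assumes n: "n \<ge> 1" and \<rho>: "\<rho> \<in> bouquet_maps n"
  shows "d_fold_symmetric n d \<rho> \<longleftrightarrow> card (map_automorphism_group n \<rho>) = d"
proof
  assume d: "card (map_automorphism_group n \<rho>) = d"
  obtain \<sigma> s where *: "semiregular s \<sigma> {1..n}" "s > 0"
    "map_automorphism_group n \<rho> = range (\<lambda>q. \<sigma> ^^ q)" "card (map_automorphism_group n \<rho>) = s"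
    by (rule map_automorphism_group_cyclic[OF n \<rho>]) (rule that; assumption)
  let ?G = "sym_group n"
  have c: "\<sigma> \<in> carrier ?G" using *(1) by (simp add: semiregular_def sym_group_carrier)
  \<comment> \<open>The stabilizer consists of powers of \<open>\<sigma>\<close>, so it lies in the
    generated subgroup; the converse holds because it is a subgroup containing
    \<open>\<sigma>\<close>.\<close>
  have "\<sigma> ^^ q \<in> generate ?G {\<sigma>}" for q
  proof (induction q)
    case 0
    then show ?case using generate.one[of ?G "{\<sigma>}"] by (simp only: funpow.simps sym_group_one)
  next
    case (Suc q)
    have "\<sigma> \<in> generate ?G {\<sigma>}" by (rule generate.incl) simp
    from generate.eng[OF this Suc] show ?case by (simp only: funpow.simps sym_group_mult)
  qed
  moreover have "generate ?G {\<sigma>} \<subseteq> map_automorphism_group n \<rho>"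
  proof (rule group.generate_subgroup_incl[OF sym_group_is_group])
    show "{\<sigma>} \<subseteq> map_automorphism_group n \<rho>" unfolding *(3) by (auto intro: range_eqI[of _ _ 1])
    show "subgroup (map_automorphism_group n \<rho>) ?G"
      unfolding map_automorphism_group_def
      by (rule group_action.stabilizer_subgroup[OF group_action_bouquet_maps \<rho>])
  qed
  ultimately have "map_automorphism_group n \<rho> = generate ?G {\<sigma>}" unfolding *(3) by blast
  moreover have "\<forall>i\<in>{1..n}. card (Orbits.orbit \<sigma> i) = d"
    using semiregular_orbit(2)[OF *(1,2)] *(4) d by simp
  ultimately show "d_fold_symmetric n d \<rho>" using c d unfolding d_fold_symmetric_def by blast
qed (auto simp: d_fold_symmetric_def)

section \<open>Counting maps with automorphisms of given order\<close>

text \<open>Each \<open>r\<close> has \<open>2 * n\<close> listings, and each admissible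
  \<open>\<sigma>\<close> is the shift by \<open>2 * m\<close> of
  \<open>fact (2 * m) * k ^ (2 * m)\<close> listings. Counting these \<open>\<sigma>\<close> by
  \<open>card_semiregular\<close> absorbs one factor \<open>k ^ m\<close>; the product form avoids
  division.\<close>

lemma card_rotations_lift_power:
  assumes n: "n \<ge> 1" and km: "k * m = n"
  shows "card {r. semiregular (2 * n) r (nbhd n Center)
             \<and> (\<exists>\<sigma>. \<sigma> permutes {1..n} \<and> lift_perm \<sigma> = r ^^ (2 * m))} * (2 * n) * fact m
         = fact n * fact (2 * m) * k ^ m"
    (is "card ?A * _ * _ = _")
proof -
  let ?V = "nbhd n Center"
  have k: "k > 0" and m: "m > 0" using n km by (auto intro: gr0I)
  \<comment> \<open>The size is factored as \<open>2 * m * k\<close> for shifts by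
    \<open>2 * m\<close> with cycles of length \<open>k\<close>, and as \<open>1 * (2 * n)\<close>
    for single steps along one full cycle.\<close>
  have V: "finite ?V" "card ?V = 2 * m * k" "card ?V = 2 * n" "card ?V = 1 * (2 * n)"
    using finite_nbhd_Center km by (auto simp: card_nbhd_Center)
  \<comment> \<open>\<open>W\<close> fibres both over the rotations to be counted and over the semiregular \<open>\<sigma> \<in> S\<^sub>n\<close>.\<close>
  define W where "W = {f \<in> cyclic_listings ?V.
    \<exists>\<sigma>. \<sigma> permutes {1..n} \<and> (\<forall>i. f (i + 2 * m) = lift_perm \<sigma> (f i))}"
  let ?U = "{\<sigma>. semiregular k \<sigma> {1..n}}"
  have "card W = card ?A * (2 * n)"
  proof (rule card_fibres_eq[where Q = "\<lambda>r f. \<forall>i. f (i + 1) = r (f i)"])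
    show "finite ?A" by (rule finite_subset[OF _ finite_semiregular[OF V(1)]]) blast
    show "2 * n > 0" using n by simp
    fix r assume r: "r \<in> ?A"
    then obtain \<sigma> where s: "\<sigma> permutes {1..n}" "lift_perm \<sigma> = r ^^ (2 * m)" by blast
    have sr: "semiregular (2 * n) r ?V" using r by blast
    have "f (i + 2 * m) = lift_perm \<sigma> (f i)" if "\<forall>i. f (i + 1) = r (f i)" for f i
      using shift_sequences_step[OF that, of i "2 * m"] s(2) by simp
    then have "{f \<in> W. \<forall>i. f (i + 1) = r (f i)} = shift_sequences 1 r ?V"
      unfolding shift_sequences_eq_cyclic_listings[OF sr V(4)] W_def using s(1) by blast
    then show "card {f \<in> W. \<forall>i. f (i + 1) = r (f i)} = 2 * n"
      using card_shift_sequences[OF sr _ V(1,4)] n by simp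
  next
    fix f assume "f \<in> W"
    then obtain \<sigma> where f: "f \<in> cyclic_listings ?V" and s: "\<sigma> permutes {1..n}"
      and fs: "\<forall>i. f (i + 2 * m) = lift_perm \<sigma> (f i)" unfolding W_def by blast
    obtain r where r: "r permutes ?V" "\<forall>i. f (i + 1) = r (f i)"
      using cyclic_listings_shift_exists[OF f V(1)] by blast
    have "semiregular (2 * n) r ?V"
      using cyclic_listings_semiregular[OF f V(1,4) _ r] by simp
    \<comment> \<open>Both sides are the shift by \<open>2 * m\<close> of the same listing.\<close>
    moreover have "lift_perm \<sigma> = r ^^ (2 * m)"
    proof (rule cyclic_listings_shift_unique[OF f _ _ fs])
      show "\<forall>i. f (i + 2 * m) = (r ^^ (2 * m)) (f i)"
        using shift_sequences_step[OF r(2), of _ "2 * m"] by simp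
    qed (use funpow_permutes[OF r(1)] lift_perm_permutes_nbhd[OF s] in auto)
    ultimately have "r \<in> ?A" using s by blast
    moreover have "r' = r" if "r' \<in> ?A" "\<forall>i. f (i + 1) = r' (f i)" for r'
      by (rule cyclic_listings_shift_unique[OF f _ r(1) that(2) r(2)])
        (use that(1) in \<open>simp add: semiregular_def\<close>)
    ultimately show "\<exists>!r. r \<in> ?A \<and> (\<forall>i. f (i + 1) = r (f i))" using r(2) by blast
  qed
  moreover have "card W = card ?U * (fact (2 * m) * k ^ (2 * m))"
  proof (rule card_fibres_eq[where Q = "\<lambda>\<sigma> f. \<forall>i. f (i + 2 * m) = lift_perm \<sigma> (f i)"])
    show "finite ?U" by (rule finite_semiregular) simp
    show "fact (2 * m) * k ^ (2 * m) > 0" using k by simp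
    fix \<sigma> assume s: "\<sigma> \<in> ?U"
    then have p: "\<sigma> permutes {1..n}" by (simp add: semiregular_def)
    then have sr: "semiregular k (lift_perm \<sigma>) ?V" using s semiregular_lift_perm_iff by blast
    have "{f \<in> W. \<forall>i. f (i + 2 * m) = lift_perm \<sigma> (f i)} = shift_sequences (2 * m) (lift_perm \<sigma>) ?V"
      unfolding shift_sequences_eq_cyclic_listings[OF sr V(2)] W_def using p by blast
    then show "card {f \<in> W. \<forall>i. f (i + 2 * m) = lift_perm \<sigma> (f i)} = fact (2 * m) * k ^ (2 * m)"
      using card_shift_sequences[OF sr k V(1,2)] m by simp
  next
    fix f assume "f \<in> W"
    then obtain \<sigma> where f: "f \<in> cyclic_listings ?V" and s: "\<sigma> permutes {1..n}"
      and fs: "\<forall>i. f (i + 2 * m) = lift_perm \<sigma> (f i)" unfolding W_def by blast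
    have "semiregular k (lift_perm \<sigma>) ?V"
      using cyclic_listings_semiregular[OF f V(1,2) _ lift_perm_permutes_nbhd[OF s] fs] m by simp
    then have "\<sigma> \<in> ?U" using semiregular_lift_perm_iff[OF s] by blast
    moreover have "\<tau> = \<sigma>" if "\<tau> \<in> ?U" "\<forall>i. f (i + 2 * m) = lift_perm \<tau> (f i)" for \<tau>
    proof -
      have "\<tau> permutes {1..n}" using that(1) by (simp add: semiregular_def)
      then have "lift_perm \<tau> = lift_perm \<sigma>"
        using that(2) fs s by (intro cyclic_listings_shift_unique[OF f] lift_perm_permutes_nbhd)
      then show ?thesis by (rule injD[OF inj_lift_perm])
    qed
    ultimately show "\<exists>!\<sigma>. \<sigma> \<in> ?U \<and> (\<forall>i. f (i + 2 * m) = lift_perm \<sigma> (f i))" using fs by blast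
  qed
  moreover have "k ^ (2 * m) = k ^ m * k ^ m" by (simp add: mult_2 power_add)
  ultimately have "card ?A * (2 * n) = card ?U * (fact (2 * m) * (k ^ m * k ^ m))" by metis
  then have eq: "card ?A * (2 * n) * fact m = card ?U * (fact m * k ^ m) * fact (2 * m) * k ^ m"
    by (simp only: mult_ac)
  have U: "card ?U * (fact m * k ^ m) = fact n"
    using card_semiregular[of "{1..n}" m k] km k m by (simp add: mult.commute)
  show ?thesis using eq unfolding U .
qed

lemma card_maps_dvd_automorphisms:
  assumes n: "n \<ge> 1" and km: "k * m = n"
  shows "card {\<rho> \<in> bouquet_maps n. k dvd card (map_automorphism_group n \<rho>)} * (2 * n) * fact m
         = fact n * fact (2 * m) * k ^ m"
proof -
  let ?V = "nbhd n Center"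
  let ?A = "{r. semiregular (2 * n) r ?V
    \<and> (\<exists>\<sigma>. \<sigma> permutes {1..n} \<and> lift_perm \<sigma> = r ^^ (2 * m))}"
  let ?B = "{\<rho> \<in> bouquet_maps n. k dvd card (map_automorphism_group n \<rho>)}"
  note bij = bij_betw_rotation_Center[OF n]
  have iff: "k dvd card (map_automorphism_group n \<rho>)
      \<longleftrightarrow> (\<exists>\<sigma>. \<sigma> permutes {1..n} \<and> lift_perm \<sigma> = \<rho> Center ^^ (2 * m))"
    if "\<rho> \<in> bouquet_maps n" for \<rho>
    using map_automorphism_group_cyclic[OF n that] km by metis
  have "bij_betw (\<lambda>\<rho>. \<rho> Center) ?B ?A"
  proof (rule bij_betw_subset[OF bij])
    have img: "(\<lambda>\<rho>. \<rho> Center) ` bouquet_maps n = {r. semiregular (2 * n) r ?V}"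
      using bij by (simp add: bij_betw_def)
    show "(\<lambda>\<rho>. \<rho> Center) ` ?B = ?A"
    proof (intro equalityI subsetI)
      fix r assume "r \<in> (\<lambda>\<rho>. \<rho> Center) ` ?B"
      then show "r \<in> ?A" using img iff by auto
    next
      fix r assume r: "r \<in> ?A"
      then have "r \<in> (\<lambda>\<rho>. \<rho> Center) ` bouquet_maps n" unfolding img by blast
      then show "r \<in> (\<lambda>\<rho>. \<rho> Center) ` ?B" using r iff by auto
    qed
  qed blast
  then have "card ?B = card ?A" by (rule bij_betw_same_card)
  then show ?thesis using card_rotations_lift_power[OF n km] by simp
qed

section \<open>Moebius inversion and passage to orbits\<close>

lemma finite_bouquet_maps: "n \<ge> 1 \<Longrightarrow> finite (bouquet_maps n)"
  using bij_betw_finite[OF bij_betw_rotation_Center] finite_semiregular[OF finite_nbhd_Center] by blast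

text \<open>After exchanging the sums, a map with \<open>s\<close> automorphisms contributes the
  Moebius sum over \<open>k\<close> with \<open>d dvd k\<close> and \<open>k dvd s\<close>, which is
  1 if \<open>s = d\<close> and 0 otherwise.\<close>

lemma card_automorphisms_eq_moebius:
  assumes n: "n \<ge> 1" and d: "d dvd n"
  shows "int (card {\<rho> \<in> bouquet_maps n. card (map_automorphism_group n \<rho>) = d})
    = (\<Sum>k | d dvd k \<and> k dvd n. moebius_mu (k div d)
        * int (card {\<rho> \<in> bouquet_maps n. k dvd card (map_automorphism_group n \<rho>)}))"
proof -
  let ?M = "bouquet_maps n" and ?s = "\<lambda>\<rho>. card (map_automorphism_group n \<rho>)"
  let ?K = "{k. d dvd k \<and> k dvd n}"
  have fin: "finite ?M" by (rule finite_bouquet_maps[OF n])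
  have finK: "finite ?K" using n by auto
  have card_eq: "int (card {\<rho> \<in> ?M. P \<rho>}) = (\<Sum>\<rho>\<in>?M. if P \<rho> then 1 else 0)" for P
    using fin by (simp add: sum.If_cases Int_def)
  have "(\<Sum>k\<in>?K. moebius_mu (k div d) * int (card {\<rho> \<in> ?M. k dvd ?s \<rho>}))
      = (\<Sum>k\<in>?K. \<Sum>\<rho>\<in>?M. if k dvd ?s \<rho> then moebius_mu (k div d) else 0)"
    unfolding card_eq sum_distrib_left by (intro sum.cong) auto
  also have "\<dots> = (\<Sum>\<rho>\<in>?M. \<Sum>k\<in>?K. if k dvd ?s \<rho> then moebius_mu (k div d) else 0)"
    by (rule sum.swap)
  also have "\<dots> = (\<Sum>\<rho>\<in>?M. if ?s \<rho> = d then 1 else 0)"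
  proof (rule sum.cong[OF refl])
    fix \<rho> assume "\<rho> \<in> ?M"
    then have s: "?s \<rho> > 0" "?s \<rho> dvd n"
      using map_automorphism_group_cyclic[OF n] by metis+
    have "(\<Sum>k\<in>?K. if k dvd ?s \<rho> then moebius_mu (k div d) else 0)
        = (\<Sum>k | d dvd k \<and> k dvd ?s \<rho>. moebius_mu (k div d))"
      using finK s(2) by (intro sum.mono_neutral_cong_right) (auto intro: dvd_trans)
    also have "\<dots> = (if ?s \<rho> = d then 1 else 0)"
      using d n s(1) by (intro sum_moebius_mu_between) (auto intro: gr0I)
    finally show "(\<Sum>k\<in>?K. if k dvd ?s \<rho> then moebius_mu (k div d) else 0)
        = (if ?s \<rho> = d then 1 else 0)" .
  qed
  finally show ?thesis unfolding card_eq by simp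
qed

text \<open>By the orbit-stabilizer theorem each orbit of maps with \<open>d\<close> automorphisms
  has \<open>fact n div d\<close> elements, and these orbits partition the set of such maps.\<close>

lemma num_d_fold_mult_fact:
  assumes n: "n \<ge> 1" and d: "d dvd n"
  shows "num_d_fold n d * fact n
    = d * card {\<rho> \<in> bouquet_maps n. card (map_automorphism_group n \<rho>) = d}"
proof -
  interpret group_action "sym_group n" "bouquet_maps n" "map_action n"
    by (rule group_action_bouquet_maps)
  let ?D = "{I \<in> unlabeled_imbeddings n. \<forall>\<rho>\<in>I. d_fold_symmetric n d \<rho>}"
  have d0: "d > 0" using n d by (auto intro: gr0I)
  have sub: "I \<subseteq> bouquet_maps n" if "I \<in> unlabeled_imbeddings n" for I
    using that orbits_coverture unfolding unlabeled_imbeddings_def by blast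
  have size: "card I * card (map_automorphism_group n \<rho>) = fact n"
    if I: "I \<in> unlabeled_imbeddings n" and "\<rho> \<in> I" for I \<rho>
  proof -
    have \<rho>: "\<rho> \<in> bouquet_maps n" using sub that by blast
    then have "Group_Action.orbit (sym_group n) (map_action n) \<rho> \<in> orbits (sym_group n) (bouquet_maps n) (map_action n)"
      by (auto simp: orbits_def)
    moreover have "\<rho> \<in> Group_Action.orbit (sym_group n) (map_action n) \<rho>" by (rule orbit_refl[OF \<rho>])
    ultimately have "Group_Action.orbit (sym_group n) (map_action n) \<rho> = I"
      using disjoint_union that unfolding unlabeled_imbeddings_def by blast
    then show ?thesis
      using orbit_stabilizer_theorem[OF \<rho>]
      by (simp add: map_automorphism_group_def order_def sym_group_card_carrier)
  qed
  have fin: "finite (bouquet_maps n)" by (rule finite_bouquet_maps[OF n])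
  have un: "\<Union>?D = {\<rho> \<in> bouquet_maps n. card (map_automorphism_group n \<rho>) = d}"
  proof (intro equalityI subsetI)
    fix \<rho> assume "\<rho> \<in> \<Union>?D"
    then show "\<rho> \<in> {\<rho> \<in> bouquet_maps n. card (map_automorphism_group n \<rho>) = d}"
      using sub d_fold_symmetric_iff[OF n] by blast
  next
    fix \<rho> assume "\<rho> \<in> {\<rho> \<in> bouquet_maps n. card (map_automorphism_group n \<rho>) = d}"
    then have \<rho>: "\<rho> \<in> bouquet_maps n" "card (map_automorphism_group n \<rho>) = d" by auto
    then obtain I where I: "I \<in> unlabeled_imbeddings n" "\<rho> \<in> I"
      using orbits_coverture unfolding unlabeled_imbeddings_def by blast
    have "d_fold_symmetric n d \<rho>'" if "\<rho>' \<in> I" for \<rho>'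
    proof -
      \<comment> \<open>All maps in \<open>I\<close> have equally many automorphisms, since the
        product with \<open>card I\<close> is always the nonzero number
        \<open>fact n\<close>.\<close>
      have "card I * card (map_automorphism_group n \<rho>') = card I * d" "card I * d \<noteq> 0"
        using size[OF I(1) that] size[OF I] \<rho>(2) by simp_all
      then show ?thesis using d_fold_symmetric_iff[OF n] sub[OF I(1)] that by auto
    qed
    then show "\<rho> \<in> \<Union>?D" using I by blast
  qed
  have "fact n div d * card ?D = card (\<Union>?D)"
  proof (rule card_partition)
    show "finite ?D" by (rule finite_subset[of _ "Pow (bouquet_maps n)"]) (use sub fin in auto)
    show "finite (\<Union>?D)" unfolding un using fin by simp
    fix I assume I: "I \<in> ?D"
    \<comment> \<open>Orbits are nonempty, so the condition on all elements of \<open>I\<close> is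
      not vacuous.\<close>
    then obtain \<rho> where \<rho>: "\<rho> \<in> I"
      unfolding unlabeled_imbeddings_def orbits_def using orbit_refl by blast
    have "card (map_automorphism_group n \<rho>) = d"
      using I \<rho> d_fold_symmetric_iff[OF n] sub by blast
    then have "card I * d = fact n" using size[of I \<rho>] I \<rho> by simp
    then show "card I = fact n div d" using d0 by (metis nonzero_mult_div_cancel_right not_gr0)
  next
    fix I I' assume "I \<in> ?D" "I' \<in> ?D" "I \<noteq> I'"
    then show "I \<inter> I' = {}" using disjoint_union unfolding unlabeled_imbeddings_def by blast
  qed
  then have "d * card {\<rho> \<in> bouquet_maps n. card (map_automorphism_group n \<rho>) = d}
      = (d * (fact n div d)) * num_d_fold n d"
    unfolding un num_d_fold_def by simp
  also have "d * (fact n div d) = fact n"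
  proof (rule dvd_mult_div_cancel)
    show "d dvd fact n" using d n d0 by (intro dvd_fact) (auto dest: dvd_imp_le)
  qed
  finally show ?thesis by simp
qed

theorem theorem14:
  fixes n d :: nat
  assumes "n \<ge> 1" and "d dvd n"
  shows "real (num_d_fold n d) =
    real d / (2 * real n) *
      (\<Sum>k | d dvd k \<and> k dvd n.
         real_of_int (moebius_mu (k div d)) *
           (fact (2 * n div k) * real k ^ (n div k) / fact (n div k)))"
proof -
  let ?B = "\<lambda>k. {\<rho> \<in> bouquet_maps n. k dvd card (map_automorphism_group n \<rho>)}"
  \<comment> \<open>Up to the factor \<open>2 * n / fact n\<close>, the term at \<open>k\<close>
    counts the maps whose number of automorphisms is divisible by \<open>k\<close>.\<close>
  have B: "fact (2 * n div k) * real k ^ (n div k) / fact (n div k)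
      = 2 * real n / fact n * real (card (?B k))" if k: "k dvd n" for k
  proof -
    obtain m where m: "k * m = n" using k by (metis dvd_def)
    then have "k > 0" using assms(1) by (auto intro: gr0I)
    then have div: "n div k = m" "2 * n div k = 2 * m" using m by (auto simp flip: m)
    have "real (card (?B k) * (2 * n) * fact m) = real (fact n * fact (2 * m) * k ^ m)"
      using card_maps_dvd_automorphisms[OF assms(1) m] by simp
    then show ?thesis unfolding div by (simp add: field_simps)
  qed
  have "(\<Sum>k | d dvd k \<and> k dvd n. real_of_int (moebius_mu (k div d)) *
           (fact (2 * n div k) * real k ^ (n div k) / fact (n div k)))
      = (\<Sum>k | d dvd k \<and> k dvd n. 2 * real n / fact n *
           real_of_int (moebius_mu (k div d) * int (card (?B k))))"
    by (intro sum.cong) (simp_all add: B)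
  also have "\<dots> = 2 * real n / fact n *
      real_of_int (\<Sum>k | d dvd k \<and> k dvd n. moebius_mu (k div d) * int (card (?B k)))"
    by (simp only: sum_distrib_left of_int_sum)
  also have "\<dots> = 2 * real n / fact n
      * real (card {\<rho> \<in> bouquet_maps n. card (map_automorphism_group n \<rho>) = d})"
    unfolding card_automorphisms_eq_moebius[OF assms, symmetric] by simp
  finally have eq: "(\<Sum>k | d dvd k \<and> k dvd n. real_of_int (moebius_mu (k div d)) *
           (fact (2 * n div k) * real k ^ (n div k) / fact (n div k)))
      = 2 * real n / fact n * real (card {\<rho> \<in> bouquet_maps n. card (map_automorphism_group n \<rho>) = d})" .
  \<comment> \<open>The factors \<open>2 * n\<close> cancel, and \<open>d / fact n\<close> turns the
    count of maps into the count of orbits.\<close>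
  have "real (num_d_fold n d * fact n)
      = real (d * card {\<rho> \<in> bouquet_maps n. card (map_automorphism_group n \<rho>) = d})"
    using num_d_fold_mult_fact[OF assms] by simp
  then show ?thesis unfolding eq using assms(1) by (simp add: field_simps)
qed

end
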